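(* Let $\psi:N^2\to\mathbb{R}^3$, $(v,w)\mapsto(v,w,f(v,w))$, be a positive definite improper affine sphere with affine normal $(0,0,1)$, and let $\gamma=(\gamma_1,\gamma_2):I\to\mathbb{R}^2$ be a curve such that $\varphi:I\times N^2\to\mathbb{R}^4$, $$\varphi(t,v,w)=(\gamma_1(t)v,\ \gamma_1(t)w,\ \gamma_1(t)f(v,w)+\gamma_2(t),\ \gamma_1(t)),$$ defines a 3-dimensional indefinite proper affine hypersphere. Then $\varphi(I\times N^2)$ admits a pointwise $\mathbb{Z}_3$- or $SO(2)$-symmetry.
   Context: $D$ is the flat connection and $\det$ the volume form of $\mathbb{R}^{n+1}$. For a nondegenerate immersed hypersurface $\varphi:M^n\to\mathbb{R}^{n+1}$ the affine (Blaschke) normal $\xi$ is the transverse vector field, unique up to sign, such that (identifying tangent vectors with their images under $\varphi_*$) $D_XY=\nabla_XY+h(X,Y)\xi$, $D_X\xi=-SX$ with $SX$ tangential, and the volume form $\det(\varphi_*X_1,\dots,\varphi_*X_n,\xi)$ equals (up to orientation) the volume form $|\det h|^{1/2}$ of $h$. $\nabla$ is the induced connection, $h$ the affine metric, $S$ the shape operator, $\widehat\nabla$ the Levi-Civita connection of $h$, and $K(X,Y)=\nabla_XY-\widehat\nabla_XY$ the difference tensor. $\varphi$ is an affine (hyper)sphere if $S=H\,\mathrm{Id}$ with $H$ constant; it is proper if $H\neq0$, improper if $H=0$, positive definite / indefinite if $h$ is. For $n=3$ and $h$ indefinite, the sign of $\xi$ is fixed so that $h$ has exactly one negative direction. $M^3$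 admits a pointwise $G$-symmetry if for every $p\in M$ there is a subgroup of the isometry group $SO(1,2)$ of $(T_pM,h)$, isomorphic to $G$, all of whose elements $L$ satisfy $K(LX_p,LY_p)=L(K(X_p,Y_p))$ for all $X_p,Y_p\in T_pM$. "Admits a pointwise $\mathbb{Z}_3$- or $SO(2)$-symmetry" means that at every point such a subgroup isomorphic to $\mathbb{Z}_3$ or to $SO(2)$ exists. *)

theory Defs
  imports "HOL-Analysis.Analysis" "HOL-Algebra.Elementary_Groups"
begin

section \<open>Smooth maps on open sets\<close>

primrec iter_deriv :: "'a list \<Rightarrow> ('a::real_normed_vector \<Rightarrow> 'b::real_normed_vector) \<Rightarrow> 'a \<Rightarrow> 'b" where
  "iter_deriv [] F = F"
| "iter_deriv (v # vs) F = (\<lambda>p. frechet_derivative (iter_deriv vs F) (at p) v)"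

text \<open>On an open set, and with finite-dimensional domain, this is the class of infinitely often
  differentiable maps: every iterated directional derivative is again differentiable.\<close>

definition smooth_on :: "'a::real_normed_vector set \<Rightarrow> ('a \<Rightarrow> 'b::real_normed_vector) \<Rightarrow> bool" where
  "smooth_on U F \<longleftrightarrow> (\<forall>vs. iter_deriv vs F differentiable_on U)"

section \<open>Bilinear forms\<close>

definition nondegenerate :: "('a::real_vector \<Rightarrow> 'a \<Rightarrow> real) \<Rightarrow> bool" where
  "nondegenerate b \<longleftrightarrow> (\<forall>x. (\<forall>y. b x y = 0) \<longrightarrow> x = 0)"

definition positive_definite :: "('a::real_vector \<Rightarrow> 'a \<Rightarrow> real) \<Rightarrow> bool" where
  "positive_definite b \<longleftrightarrow> (\<forall>x. x \<noteq> 0 \<longrightarrow> 0 < b x x)"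

definition indefinite :: "('a::real_vector \<Rightarrow> 'a \<Rightarrow> real) \<Rightarrow> bool" where
  "indefinite b \<longleftrightarrow> (\<exists>x. 0 < b x x) \<and> (\<exists>x. b x x < 0)"

definition negative_index :: "('a::euclidean_space \<Rightarrow> 'a \<Rightarrow> real) \<Rightarrow> nat" where
  "negative_index b = Max (dim ` {V. subspace V \<and> (\<forall>x\<in>V. x \<noteq> 0 \<longrightarrow> b x x < 0)})"

section \<open>Affine hypersurface theory\<close>

text \<open>Hypersurfaces are parametrized by an open subset \<open>U\<close> of \<open>real^'n\<close>; the tangent space at
  \<open>p \<in> U\<close> is \<open>real^'n\<close>, and tangent vectors are pushed forward by the derivative of \<open>\<phi>\<close> at \<open>p\<close>.
  Vector fields are functions \<open>real^'n \<Rightarrow> real^'n\<close>.\<close>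

abbreviation push :: "(real^'n \<Rightarrow> real^'m) \<Rightarrow> real^'n \<Rightarrow> real^'n \<Rightarrow> real^'m" where
  "push \<phi> p \<equiv> frechet_derivative \<phi> (at p)"

definition immersed_hypersurface :: "(real^'n) set \<Rightarrow> (real^'n \<Rightarrow> real^'m) \<Rightarrow> bool" where
  "immersed_hypersurface U \<phi> \<longleftrightarrow>
     CARD('m) = CARD('n) + 1 \<and> open U \<and> smooth_on U \<phi> \<and> (\<forall>p\<in>U. inj (push \<phi> p))"

text \<open>Components of an ambient vector \<open>u\<close> at \<open>p\<close> along the hypersurface and along the transverse
  vector field \<open>\<xi>\<close>.\<close>

definition tang_part :: "(real^'n \<Rightarrow> real^'m) \<Rightarrow> (real^'n \<Rightarrow> real^'m) \<Rightarrow> real^'n \<Rightarrow> real^'m \<Rightarrow> real^'n" where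
  "tang_part \<phi> \<xi> p u = (THE x. \<exists>c. u = push \<phi> p x + c *\<^sub>R \<xi> p)"

definition transv_part :: "(real^'n \<Rightarrow> real^'m) \<Rightarrow> (real^'n \<Rightarrow> real^'m) \<Rightarrow> real^'n \<Rightarrow> real^'m \<Rightarrow> real" where
  "transv_part \<phi> \<xi> p u = (THE c. \<exists>x. u = push \<phi> p x + c *\<^sub>R \<xi> p)"

text \<open>The ambient derivative \<open>D\<^sub>X Y\<close> of the tangent field \<open>Y\<close>, viewed as a field along \<open>\<phi>\<close>.\<close>

definition flat_deriv ::
  "(real^'n \<Rightarrow> real^'m) \<Rightarrow> (real^'n \<Rightarrow> real^'n) \<Rightarrow> (real^'n \<Rightarrow> real^'n) \<Rightarrow> real^'n \<Rightarrow> real^'m" where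
  "flat_deriv \<phi> X Y p = frechet_derivative (\<lambda>q. push \<phi> q (Y q)) (at p) (X p)"

definition induced_conn :: "(real^'n \<Rightarrow> real^'m) \<Rightarrow> (real^'n \<Rightarrow> real^'m) \<Rightarrow>
    (real^'n \<Rightarrow> real^'n) \<Rightarrow> (real^'n \<Rightarrow> real^'n) \<Rightarrow> real^'n \<Rightarrow> real^'n" where
  "induced_conn \<phi> \<xi> X Y p = tang_part \<phi> \<xi> p (flat_deriv \<phi> X Y p)"

text \<open>\<open>h\<close> is tensorial, so its value at \<open>x, y\<close> may be computed with the constant fields extending
  \<open>x, y\<close>; likewise for the difference tensor below.\<close>

definition affine_metric :: "(real^'n \<Rightarrow> real^'m) \<Rightarrow> (real^'n \<Rightarrow> real^'m) \<Rightarrow>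
    real^'n \<Rightarrow> real^'n \<Rightarrow> real^'n \<Rightarrow> real" where
  "affine_metric \<phi> \<xi> p x y = transv_part \<phi> \<xi> p (flat_deriv \<phi> (\<lambda>_. x) (\<lambda>_. y) p)"

definition shape_op :: "(real^'n \<Rightarrow> real^'m) \<Rightarrow> (real^'n \<Rightarrow> real^'m) \<Rightarrow> real^'n \<Rightarrow> real^'n \<Rightarrow> real^'n" where
  "shape_op \<phi> \<xi> p x = - tang_part \<phi> \<xi> p (frechet_derivative \<xi> (at p) x)"

text \<open>In the volume condition, \<open>e\<close> merely enumerates the \<open>n + 1\<close> vectors
  \<open>\<phi>\<^sub>* X\<^sub>1, \<dots>, \<phi>\<^sub>* X\<^sub>n, \<xi>\<close> (\<open>None\<close> standing for \<open>\<xi>\<close>) by the index type of the ambient space;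
  the absolute value of the determinant does not depend on the choice of \<open>e\<close>. The right-hand side
  is the volume form of \<open>h\<close> evaluated on \<open>X\<^sub>1, \<dots>, X\<^sub>n\<close>.\<close>

definition affine_normal :: "(real^'n) set \<Rightarrow> (real^'n \<Rightarrow> real^'m) \<Rightarrow> (real^'n \<Rightarrow> real^'m) \<Rightarrow> bool" where
  "affine_normal U \<phi> \<xi> \<longleftrightarrow>
     immersed_hypersurface U \<phi> \<and> smooth_on U \<xi> \<and>
     (\<forall>p\<in>U.
        \<xi> p \<notin> range (push \<phi> p) \<and>
        nondegenerate (affine_metric \<phi> \<xi> p) \<and>
        (\<forall>x. frechet_derivative \<xi> (at p) x \<in> range (push \<phi> p)) \<and>
        (\<forall>(e :: 'm \<Rightarrow> 'n option) X. bij e \<longrightarrow>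
           \<bar>det (\<chi> i. case e i of None \<Rightarrow> \<xi> p | Some k \<Rightarrow> push \<phi> p (X k))\<bar> =
           sqrt \<bar>det (\<chi> i j. affine_metric \<phi> \<xi> p (X i) (X j))\<bar>))"

text \<open>An affine hypersphere with affine normal \<open>\<xi>\<close> and constant \<open>H\<close>; it is proper if \<open>H \<noteq> 0\<close> and
  improper if \<open>H = 0\<close>.\<close>

definition affine_hypersphere ::
  "(real^'n) set \<Rightarrow> (real^'n \<Rightarrow> real^'m) \<Rightarrow> (real^'n \<Rightarrow> real^'m) \<Rightarrow> real \<Rightarrow> bool" where
  "affine_hypersphere U \<phi> \<xi> H \<longleftrightarrow>
     affine_normal U \<phi> \<xi> \<and> (\<forall>p\<in>U. \<forall>x. shape_op \<phi> \<xi> p x = H *\<^sub>R x)"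

section \<open>Levi-Civita connection and difference tensor\<close>

text \<open>Every affine connection at \<open>p\<close> is the directional derivative plus a bilinear map \<open>\<Gamma>\<close>
  (the Christoffel symbols).\<close>

definition cov_deriv :: "('a::euclidean_space \<Rightarrow> 'a \<Rightarrow> 'a) \<Rightarrow> ('a \<Rightarrow> 'a) \<Rightarrow> ('a \<Rightarrow> 'a) \<Rightarrow> 'a \<Rightarrow> 'a" where
  "cov_deriv \<Gamma> X Y p = frechet_derivative Y (at p) (X p) + \<Gamma> (X p) (Y p)"

definition lie_bracket :: "('a::euclidean_space \<Rightarrow> 'a) \<Rightarrow> ('a \<Rightarrow> 'a) \<Rightarrow> 'a \<Rightarrow> 'a" where
  "lie_bracket X Y p = frechet_derivative Y (at p) (X p) - frechet_derivative X (at p) (Y p)"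

text \<open>The Christoffel symbols at \<open>p\<close> of the torsion-free metric connection of \<open>g\<close>.\<close>

definition levi_civita_symbol ::
  "('a::euclidean_space \<Rightarrow> 'a \<Rightarrow> 'a \<Rightarrow> real) \<Rightarrow> 'a \<Rightarrow> 'a \<Rightarrow> 'a \<Rightarrow> 'a" where
  "levi_civita_symbol g p = (THE \<Gamma>. bilinear \<Gamma> \<and>
     (\<forall>X Y Z. X differentiable (at p) \<longrightarrow> Y differentiable (at p) \<longrightarrow> Z differentiable (at p) \<longrightarrow>
        cov_deriv \<Gamma> X Y p - cov_deriv \<Gamma> Y X p = lie_bracket X Y p \<and>
        frechet_derivative (\<lambda>q. g q (Y q) (Z q)) (at p) (X p) =
          g p (cov_deriv \<Gamma> X Y p) (Z p) + g p (Y p) (cov_deriv \<Gamma> X Z p)))"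

definition levi_civita ::
  "('a::euclidean_space \<Rightarrow> 'a \<Rightarrow> 'a \<Rightarrow> real) \<Rightarrow> ('a \<Rightarrow> 'a) \<Rightarrow> ('a \<Rightarrow> 'a) \<Rightarrow> 'a \<Rightarrow> 'a" where
  "levi_civita g X Y p = cov_deriv (levi_civita_symbol g p) X Y p"

definition difference_tensor :: "(real^'n \<Rightarrow> real^'m) \<Rightarrow> (real^'n \<Rightarrow> real^'m) \<Rightarrow>
    real^'n \<Rightarrow> real^'n \<Rightarrow> real^'n \<Rightarrow> real^'n" where
  "difference_tensor \<phi> \<xi> p x y =
     induced_conn \<phi> \<xi> (\<lambda>_. x) (\<lambda>_. y) p - levi_civita (affine_metric \<phi> \<xi>) (\<lambda>_. x) (\<lambda>_. y) p"

section \<open>Pointwise symmetry\<close>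

text \<open>The special orthogonal group of a symmetric bilinear form; \<open>SO(1,2)\<close> if the form is
  Lorentzian on a three-dimensional space.\<close>

definition special_isometry_group :: "(real^'n \<Rightarrow> real^'n \<Rightarrow> real) \<Rightarrow> (real^'n \<Rightarrow> real^'n) monoid" where
  "special_isometry_group b =
     \<lparr>carrier = {L. linear L \<and> det (matrix L) = 1 \<and> (\<forall>x y. b (L x) (L y) = b x y)},
      monoid.mult = (\<circ>), one = id\<rparr>"

definition SO2 :: "(real^2^2) monoid" where
  "SO2 = \<lparr>carrier = {A. orthogonal_matrix A \<and> det A = 1}, monoid.mult = (**), one = mat 1\<rparr>"

abbreviation Z3 :: "int monoid" where
  "Z3 \<equiv> integer_mod_group 3"

definition symmetry_at :: "(real^'n \<Rightarrow> real^'m) \<Rightarrow> (real^'n \<Rightarrow> real^'m) \<Rightarrow> real^'n \<Rightarrow> 'g monoid \<Rightarrow> bool" where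
  "symmetry_at \<phi> \<xi> p G \<longleftrightarrow>
     (\<exists>\<H>. subgroup \<H> (special_isometry_group (affine_metric \<phi> \<xi> p)) \<and>
          special_isometry_group (affine_metric \<phi> \<xi> p) \<lparr>carrier := \<H>\<rparr> \<cong> G \<and>
          (\<forall>L\<in>\<H>. \<forall>x y. difference_tensor \<phi> \<xi> p (L x) (L y) = L (difference_tensor \<phi> \<xi> p x y)))"

section \<open>The two hypersurfaces\<close>

definition graph_surface :: "(real^2 \<Rightarrow> real) \<Rightarrow> real^2 \<Rightarrow> real^3" where
  "graph_surface f x = vector [x$1, x$2, f x]"

text \<open>The domain \<open>I \<times> N\<close> as a subset of \<open>real^3\<close>, with coordinates \<open>(t, v, w)\<close>.\<close>

definition product_domain :: "real set \<Rightarrow> (real^2) set \<Rightarrow> (real^3) set" where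
  "product_domain I N = {x. x$1 \<in> I \<and> vector [x$2, x$3] \<in> N}"

definition warped_hypersurface :: "(real \<Rightarrow> real^2) \<Rightarrow> (real^2 \<Rightarrow> real) \<Rightarrow> real^3 \<Rightarrow> real^4" where
  "warped_hypersurface \<gamma> f x =
     (let t = x$1; v = x$2; w = x$3 in
      vector [\<gamma> t $ 1 * v, \<gamma> t $ 1 * w, \<gamma> t $ 1 * f (vector [v, w]) + \<gamma> t $ 2, \<gamma> t $ 1])"

end

theory Submission
  imports Defs
begin

text \<open>Write \<open>e3 = (0, 0, 1, 0)\<close>. The second derivative of \<open>\<phi>\<close> is tangential up to the multiple
  \<open>Q(u, v) e3\<close> with \<open>Q = \<kappa>(t) dt\<^sup>2 + \<gamma>\<^sub>1(t) Hess f\<close>. Decomposing \<open>e3 = \<phi>\<^sub>* Z + c \<xi>\<close>, the affine metric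
  is \<open>c Q\<close>, and \<open>Q e3\<close> contributes \<open>Q Z\<close> to the induced connection. Since \<open>det (Hess f) = 1\<close>, the volume
  condition on \<open>\<xi>\<close> expresses a power of \<open>c\<close> through \<open>t\<close> alone; as \<open>D\<xi>\<close> is tangential, this forces
  \<open>Z\<close> to be a multiple of \<open>\<partial>\<^sub>t\<close>. By the Koszul formula the form \<open>h(K(u, v), w)\<close> is then built from
  \<open>dt\<close>, \<open>Hess f\<close> and the third derivative of \<open>f\<close> only. Differentiating \<open>det (Hess f) = 1\<close> shows that
  the latter is a traceless cubic form on a Euclidean plane, hence invariant under the rotation
  by a third of a full turn. So the symmetry group always contains a copy of \<open>\<int>/3\<close>.\<close>

section \<open>Vectors and determinants in low dimension\<close>

lemma axis_nth_eq: "axis k c $ i = (if i = k then c else 0)"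
  by (simp add: axis_def)

lemma vector_4 [simp]:
  "(vector [w, x, y, z] :: 'a::zero^4) $ 1 = w"
  "(vector [w, x, y, z] :: 'a::zero^4) $ 2 = x"
  "(vector [w, x, y, z] :: 'a::zero^4) $ 3 = y"
  "(vector [w, x, y, z] :: 'a::zero^4) $ 4 = z"
  by (simp_all add: vector_def)

text \<open>Splits one index at a time off the sum over permutations; used for the frame determinant
  in \<open>volume\<close>.\<close>

lemma det_4:
  "det (A::'a::comm_ring_1^4^4) =
    A$1$1 * (A$2$2 * A$3$3 * A$4$4 + A$2$3 * A$3$4 * A$4$2 + A$2$4 * A$3$2 * A$4$3
           - A$2$2 * A$3$4 * A$4$3 - A$2$3 * A$3$2 * A$4$4 - A$2$4 * A$3$3 * A$4$2)
  - A$1$2 * (A$2$1 * A$3$3 * A$4$4 + A$2$3 * A$3$4 * A$4$1 + A$2$4 * A$3$1 * A$4$3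
           - A$2$1 * A$3$4 * A$4$3 - A$2$3 * A$3$1 * A$4$4 - A$2$4 * A$3$3 * A$4$1)
  + A$1$3 * (A$2$1 * A$3$2 * A$4$4 + A$2$2 * A$3$4 * A$4$1 + A$2$4 * A$3$1 * A$4$2
           - A$2$1 * A$3$4 * A$4$2 - A$2$2 * A$3$1 * A$4$4 - A$2$4 * A$3$2 * A$4$1)
  - A$1$4 * (A$2$1 * A$3$2 * A$4$3 + A$2$2 * A$3$3 * A$4$1 + A$2$3 * A$3$1 * A$4$2
           - A$2$1 * A$3$3 * A$4$2 - A$2$2 * A$3$1 * A$4$3 - A$2$3 * A$3$2 * A$4$1)"
proof -
  have f1: "finite {2::4, 3, 4}" "1 \<notin> {2::4, 3, 4}" by auto
  have f2: "finite {3::4, 4}" "2 \<notin> {3::4, 4}" by auto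
  have f3: "finite {4::4}" "3 \<notin> {4::4}" by auto
  show ?thesis
    unfolding det_def UNIV_4
    unfolding sum_over_permutations_insert[OF f1]
    unfolding sum_over_permutations_insert[OF f2]
    unfolding sum_over_permutations_insert[OF f3]
    unfolding permutes_sing
    by (simp add: sign_swap_id permutation_swap_id permutation_compose sign_compose sign_id swap_id_eq algebra_simps)
qed

section \<open>Iterated derivatives\<close>

text \<open>Schwarz's theorem for directional derivatives. The second difference is symmetric in
  \<open>v\<close> and \<open>w\<close>, and continuity of both mixed derivatives at
  \<open>p\<close> lets its two mean value representations pass to the limit.\<close>

lemma symmetric_second_derivative:
  fixes F :: "'a::real_normed_vector \<Rightarrow> real"
  assumes "open U" "p \<in> U"
    and F: "\<And>q. q \<in> U \<Longrightarrow> F differentiable (at q)"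
    and Fv: "\<And>q. q \<in> U \<Longrightarrow> (\<lambda>r. frechet_derivative F (at r) v) differentiable (at q)"
    and Fw: "\<And>q. q \<in> U \<Longrightarrow> (\<lambda>r. frechet_derivative F (at r) w) differentiable (at q)"
    and cvw: "isCont (\<lambda>q. frechet_derivative (\<lambda>r. frechet_derivative F (at r) w) (at q) v) p"
    and cwv: "isCont (\<lambda>q. frechet_derivative (\<lambda>r. frechet_derivative F (at r) v) (at q) w) p"
  shows "frechet_derivative (\<lambda>r. frechet_derivative F (at r) w) (at p) v =
         frechet_derivative (\<lambda>r. frechet_derivative F (at r) v) (at p) w"
proof -
  define D where "D v w q = frechet_derivative (\<lambda>r. frechet_derivative F (at r) w) (at q) v" for v w q
  obtain e where e: "e > 0" "ball p e \<subseteq> U" using assms(1,2) open_contains_ball by blast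
  text \<open>The second difference quotient of \<open>F\<close> is a value of either mixed derivative near \<open>p\<close>.\<close>
  have mv: "\<exists>a\<in>{0..s}. \<exists>b\<in>{0..s}.
      F (p + s *\<^sub>R v + s *\<^sub>R w) - F (p + s *\<^sub>R v) - F (p + s *\<^sub>R w) + F p
        = s * s * D v w (p + a *\<^sub>R v + b *\<^sub>R w)"
    if s: "0 < s" "s * (norm v + norm w) < e"
      and dw: "\<And>q. q \<in> U \<Longrightarrow> (\<lambda>r. frechet_derivative F (at r) w) differentiable (at q)" for s v w
  proof -
    have inU: "p + a *\<^sub>R v + b *\<^sub>R w \<in> U" if "0 \<le> a" "a \<le> s" "0 \<le> b" "b \<le> s" for a b
    proof -
      have "norm (a *\<^sub>R v + b *\<^sub>R w) \<le> a * norm v + b * norm w"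
        using that norm_triangle_ineq[of "a *\<^sub>R v" "b *\<^sub>R w"] by simp
      also have "\<dots> \<le> s * norm v + s * norm w"
        using that by (intro add_mono mult_right_mono) auto
      finally have "norm (a *\<^sub>R v + b *\<^sub>R w) < e" using s by (simp add: algebra_simps)
      then have "p + (a *\<^sub>R v + b *\<^sub>R w) \<in> ball p e" by (metis add_diff_cancel_left' dist_commute dist_norm mem_ball)
      then show ?thesis using e by (auto simp: add.assoc)
    qed
    \<comment> \<open>The increment of \<open>F\<close> along \<open>v\<close>. The mean value
      theorem is applied to it along \<open>w\<close>, and then along \<open>v\<close> to the
      derivative of \<open>F\<close> in direction \<open>w\<close>.\<close>
    define G where "G b = F (p + s *\<^sub>R v + b *\<^sub>R w) - F (p + b *\<^sub>R w)" for b
    have dF: "((\<lambda>b. F (q + b *\<^sub>R w)) has_real_derivative frechet_derivative F (at (q + b *\<^sub>R w)) w) (at b)"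
      if "q + b *\<^sub>R w \<in> U" for q b
    proof -
      have "(F has_derivative frechet_derivative F (at (q + b *\<^sub>R w))) (at (q + b *\<^sub>R w))"
        using F[OF that] frechet_derivative_works by blast
      then have "((\<lambda>b. F (q + b *\<^sub>R w)) has_derivative (\<lambda>h. frechet_derivative F (at (q + b *\<^sub>R w)) (h *\<^sub>R w))) (at b)"
        by (rule has_derivative_compose[rotated]) (auto intro!: derivative_eq_intros)
      moreover have "frechet_derivative F (at (q + b *\<^sub>R w)) (h *\<^sub>R w) = frechet_derivative F (at (q + b *\<^sub>R w)) w * h" for h
        using linear_scale[OF linear_frechet_derivative[OF F[OF that]]] by simp
      ultimately show ?thesis by (simp add: has_field_derivative_def)
    qed
    have "\<exists>b. 0 < b \<and> b < s \<and> G s - G 0 = (s - 0) *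
       (frechet_derivative F (at (p + s *\<^sub>R v + b *\<^sub>R w)) w - frechet_derivative F (at (p + b *\<^sub>R w)) w)"
    proof (rule MVT2[OF s(1)])
      fix b assume "0 \<le> b" "b \<le> s"
      then show "(G has_real_derivative (frechet_derivative F (at (p + s *\<^sub>R v + b *\<^sub>R w)) w - frechet_derivative F (at (p + b *\<^sub>R w)) w)) (at b)"
        unfolding G_def using inU[of s b] inU[of 0 b] s by (intro DERIV_diff dF) auto
    qed
    then obtain b where b: "0 < b" "b < s" and Gb: "G s - G 0 = s *
       (frechet_derivative F (at (p + s *\<^sub>R v + b *\<^sub>R w)) w - frechet_derivative F (at (p + b *\<^sub>R w)) w)"
      by auto
    have "\<exists>a. 0 < a \<and> a < s \<and> frechet_derivative F (at (p + s *\<^sub>R v + b *\<^sub>R w)) w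
        - frechet_derivative F (at (p + 0 *\<^sub>R v + b *\<^sub>R w)) w = (s - 0) * D v w (p + a *\<^sub>R v + b *\<^sub>R w)"
    proof (rule MVT2[OF s(1)])
      fix a assume "0 \<le> a" "a \<le> s"
      then have U: "p + a *\<^sub>R v + b *\<^sub>R w \<in> U" using inU b by auto
      let ?H = "\<lambda>r. frechet_derivative F (at r) w"
      have "(?H has_derivative frechet_derivative ?H (at (p + a *\<^sub>R v + b *\<^sub>R w))) (at (p + a *\<^sub>R v + b *\<^sub>R w))"
        using dw[OF U] frechet_derivative_works by blast
      then have "((\<lambda>a. ?H (p + a *\<^sub>R v + b *\<^sub>R w)) has_derivative (\<lambda>h. frechet_derivative ?H (at (p + a *\<^sub>R v + b *\<^sub>R w)) (h *\<^sub>R v))) (at a)"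
        by (rule has_derivative_compose[rotated]) (auto intro!: derivative_eq_intros)
      moreover have "frechet_derivative ?H (at (p + a *\<^sub>R v + b *\<^sub>R w)) (h *\<^sub>R v) = D v w (p + a *\<^sub>R v + b *\<^sub>R w) * h" for h
        unfolding D_def using linear_scale[OF linear_frechet_derivative[OF dw[OF U]]] by simp
      ultimately show "((\<lambda>a. ?H (p + a *\<^sub>R v + b *\<^sub>R w)) has_real_derivative D v w (p + a *\<^sub>R v + b *\<^sub>R w)) (at a)"
        by (simp add: has_field_derivative_def)
    qed
    then obtain a where a: "0 < a" "a < s" and "frechet_derivative F (at (p + s *\<^sub>R v + b *\<^sub>R w)) w
        - frechet_derivative F (at (p + b *\<^sub>R w)) w = s * D v w (p + a *\<^sub>R v + b *\<^sub>R w)" by auto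
    with Gb have "G s - G 0 = s * s * D v w (p + a *\<^sub>R v + b *\<^sub>R w)" by simp
    then show ?thesis using a b unfolding G_def
      by (intro bexI[of _ a] bexI[of _ b]) (auto simp: algebra_simps)
  qed
  have "\<bar>D v w p - D w v p\<bar> \<le> \<epsilon>" if e0: "\<epsilon> > 0" for \<epsilon>
  proof -
    obtain d1 where d1: "d1 > 0" "\<And>q. dist q p < d1 \<Longrightarrow> \<bar>D v w q - D v w p\<bar> < \<epsilon> / 2"
      using cvw half_gt_zero[OF e0] unfolding continuous_at_eps_delta D_def[symmetric] dist_real_def
      by blast
    obtain d2 where d2: "d2 > 0" "\<And>q. dist q p < d2 \<Longrightarrow> \<bar>D w v q - D w v p\<bar> < \<epsilon> / 2"
      using cwv half_gt_zero[OF e0] unfolding continuous_at_eps_delta D_def[symmetric] dist_real_def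
      by blast
    define d where "d = min e (min d1 d2)"
    have d: "d > 0" "d \<le> e" "d \<le> d1" "d \<le> d2" using e d1 d2 by (auto simp: d_def)
    \<comment> \<open>Keeps every intermediate point within \<open>d\<close> of \<open>p\<close>;
      the summand 1 makes the denominator positive even if \<open>v\<close> and \<open>w\<close>
      both vanish.\<close>
    define s where "s = d / (2 * (norm v + norm w + 1))"
    have n: "norm v + norm w + 1 > 0" by (smt (verit) norm_ge_zero)
    have s: "s > 0" using d n by (simp add: s_def)
    have "s * (norm v + norm w) < s * (2 * (norm v + norm w + 1))"
      by (intro mult_strict_left_mono[OF _ s]) (smt (verit) norm_ge_zero)
    also have "\<dots> = d" using n by (simp add: s_def)
    finally have sd: "s * (norm v + norm w) < d" .
    have near: "dist (p + a *\<^sub>R x + b *\<^sub>R y) p < d"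
      if "a \<in> {0..s}" "b \<in> {0..s}" "norm x + norm y = norm v + norm w" for a b x y
    proof -
      have "norm (a *\<^sub>R x + b *\<^sub>R y) \<le> a * norm x + b * norm y"
        using that norm_triangle_ineq[of "a *\<^sub>R x" "b *\<^sub>R y"] by simp
      also have "\<dots> \<le> s * norm x + s * norm y"
        using that by (intro add_mono mult_right_mono) auto
      also have "\<dots> = s * (norm v + norm w)" using that by (metis distrib_left)
      finally show ?thesis using sd by (simp add: dist_norm add.assoc)
    qed
    obtain a b where ab: "a \<in> {0..s}" "b \<in> {0..s}"
      and 1: "F (p + s *\<^sub>R v + s *\<^sub>R w) - F (p + s *\<^sub>R v) - F (p + s *\<^sub>R w) + F p
        = s * s * D v w (p + a *\<^sub>R v + b *\<^sub>R w)"
      using mv[of s v w] Fw s sd d by fastforce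
    obtain a' b' where ab': "a' \<in> {0..s}" "b' \<in> {0..s}"
      and 2: "F (p + s *\<^sub>R w + s *\<^sub>R v) - F (p + s *\<^sub>R w) - F (p + s *\<^sub>R v) + F p
        = s * s * D w v (p + a' *\<^sub>R w + b' *\<^sub>R v)"
      using mv[of s w v] Fv s sd d by (fastforce simp: add.commute)
    have "s * s * D v w (p + a *\<^sub>R v + b *\<^sub>R w) = s * s * D w v (p + a' *\<^sub>R w + b' *\<^sub>R v)"
      unfolding 1[symmetric] 2[symmetric] by (simp add: algebra_simps)
    then have "D v w (p + a *\<^sub>R v + b *\<^sub>R w) = D w v (p + a' *\<^sub>R w + b' *\<^sub>R v)" using s by simp
    moreover have "\<bar>D v w (p + a *\<^sub>R v + b *\<^sub>R w) - D v w p\<bar> < \<epsilon> / 2"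
      using near[OF ab, of v w] d by (intro d1) linarith
    moreover have "\<bar>D w v (p + a' *\<^sub>R w + b' *\<^sub>R v) - D w v p\<bar> < \<epsilon> / 2"
      using near[OF ab', of w v] d by (intro d2) linarith
    ultimately show ?thesis by linarith
  qed
  then have "\<bar>D v w p - D w v p\<bar> \<le> 0" by (rule field_le_epsilon) simp
  then show ?thesis by (simp add: D_def)
qed

lemma smooth_on_differentiable:
  assumes "smooth_on U F" "open U" "p \<in> U"
  shows "iter_deriv vs F differentiable (at p)"
  using assms at_within_open[OF assms(3,2)] unfolding smooth_on_def differentiable_on_def by metis

lemma smooth_on_has_derivative:
  assumes "smooth_on U F" "open U" "p \<in> U"
  shows "(iter_deriv vs F has_derivative (\<lambda>v. iter_deriv (v # vs) F p)) (at p)"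
  using smooth_on_differentiable[OF assms] by (simp add: frechet_derivative_works)

text \<open>Used to pass to components of vector-valued maps. A derivative at \<open>p\<close>
  depends on the values around \<open>p\<close>, so the induction keeps the point arbitrary in the
  open set \<open>U\<close>.\<close>

lemma iter_deriv_bounded_linear:
  assumes "bounded_linear L" "smooth_on U F" "open U" "p \<in> U"
  shows "iter_deriv vs (\<lambda>q. L (F q)) p = L (iter_deriv vs F p)"
  using assms(4)
proof (induction vs arbitrary: p)
  case (Cons v vs)
  have "((\<lambda>q. L (iter_deriv vs F q)) has_derivative (\<lambda>w. L (iter_deriv (w # vs) F p))) (at p)"
    using smooth_on_has_derivative[OF assms(2,3) Cons.prems] by (rule bounded_linear.has_derivative[OF assms(1)])
  then have "(iter_deriv vs (\<lambda>q. L (F q)) has_derivative (\<lambda>w. L (iter_deriv (w # vs) F p))) (at p)"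
    by (rule has_derivative_transform_within_open[OF _ assms(3) Cons.prems]) (simp add: Cons.IH)
  from frechet_derivative_at[OF this] show ?case by (metis iter_deriv.simps(2))
qed simp

lemma smooth_on_bounded_linear:
  assumes "bounded_linear L" "smooth_on U F" "open U"
  shows "smooth_on U (\<lambda>q. L (F q))"
  unfolding smooth_on_def differentiable_on_def
proof (intro allI ballI)
  fix vs p assume p: "p \<in> U"
  have "((\<lambda>q. L (iter_deriv vs F q)) has_derivative (\<lambda>w. L (iter_deriv (w # vs) F p))) (at p)"
    using smooth_on_has_derivative[OF assms(2,3) p] by (rule bounded_linear.has_derivative[OF assms(1)])
  then have "(iter_deriv vs (\<lambda>q. L (F q)) has_derivative (\<lambda>w. L (iter_deriv (w # vs) F p))) (at p)"
    by (rule has_derivative_transform_within_open[OF _ assms(3) p])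
      (simp add: iter_deriv_bounded_linear[OF assms])
  then show "iter_deriv vs (\<lambda>q. L (F q)) differentiable at p within U"
    using differentiable_def differentiable_at_withinI by blast
qed

text \<open>Swaps only the two outermost directions; an exchange further inside comes from
  differentiating such an identity, as in \<open>F3_sym\<close>.\<close>

lemma smooth_on_symmetric:
  fixes F :: "'a::real_normed_vector \<Rightarrow> real"
  assumes "smooth_on U F" "open U" "p \<in> U"
  shows "iter_deriv (v # w # vs) F p = iter_deriv (w # v # vs) F p"
proof -
  have *: "isCont (iter_deriv vs F) p" for vs
    using smooth_on_differentiable[OF assms] by (simp add: differentiable_imp_continuous_within)
  show ?thesis
    using symmetric_second_derivative[OF assms(2,3), of "iter_deriv vs F" v w]
      smooth_on_differentiable[OF assms(1,2)] *[of "[v,w] @ vs"] *[of "[w,v] @ vs"]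
       smooth_on_differentiable[OF assms(1,2), of _ "v # vs"]
       smooth_on_differentiable[OF assms(1,2), of _ "w # vs"]
    by simp
qed

text \<open>For empty \<open>us\<close> this is linearity of the derivative; each further outer
  direction differentiates the linearity equations, which hold on all of \<open>U\<close>.\<close>

lemma smooth_on_iter_deriv_linear:
  assumes "smooth_on U F" "open U" "p \<in> U"
  shows "linear (\<lambda>v. iter_deriv (us @ v # vs) F p)"
  using assms(3)
proof (induction us arbitrary: p)
  case Nil
  then show ?case using linear_frechet_derivative[OF smooth_on_differentiable[OF assms(1,2)]] by simp
next
  case (Cons u us)
  note d = smooth_on_has_derivative[OF assms(1,2) Cons.prems]
  show ?case
  proof (rule linearI)
    fix x y
    have "((\<lambda>q. iter_deriv (us @ x # vs) F q + iter_deriv (us @ y # vs) F q) has_derivative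
      (\<lambda>u. iter_deriv (u # us @ x # vs) F p + iter_deriv (u # us @ y # vs) F p)) (at p)"
      by (intro has_derivative_add d)
    then have "(iter_deriv (us @ (x + y) # vs) F has_derivative
      (\<lambda>u. iter_deriv (u # us @ x # vs) F p + iter_deriv (u # us @ y # vs) F p)) (at p)"
      by (rule has_derivative_transform_within_open[OF _ assms(2) Cons.prems]) (simp add: linear_add[OF Cons.IH])
    from has_derivative_unique[OF this d]
    show "iter_deriv ((u # us) @ (x + y) # vs) F p = iter_deriv ((u # us) @ x # vs) F p + iter_deriv ((u # us) @ y # vs) F p"
      by (metis append_Cons)
  next
    fix r x
    have "((\<lambda>q. r *\<^sub>R iter_deriv (us @ x # vs) F q) has_derivative
      (\<lambda>u. r *\<^sub>R iter_deriv (u # us @ x # vs) F p)) (at p)"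
      by (intro has_derivative_scaleR_right d)
    then have "(iter_deriv (us @ (r *\<^sub>R x) # vs) F has_derivative
      (\<lambda>u. r *\<^sub>R iter_deriv (u # us @ x # vs) F p)) (at p)"
      by (rule has_derivative_transform_within_open[OF _ assms(2) Cons.prems]) (simp add: linear_scale[OF Cons.IH])
    from has_derivative_unique[OF this d]
    show "iter_deriv ((u # us) @ (r *\<^sub>R x) # vs) F p = r *\<^sub>R iter_deriv ((u # us) @ x # vs) F p"
      by (metis append_Cons)
  qed
qed

section \<open>The Koszul formula\<close>

lemma bilinear_eq_sum_Basis:
  fixes b :: "'a::euclidean_space \<Rightarrow> 'a \<Rightarrow> real"
  assumes "bilinear b"
  shows "b x y = (\<Sum>i\<in>Basis. \<Sum>j\<in>Basis. (x \<bullet> i) * (y \<bullet> j) * b i j)"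
proof -
  have l: "linear (\<lambda>x. b x y)" "linear (b x)" for x y using assms by (auto simp: bilinear_def)
  have "b x y = b (\<Sum>i\<in>Basis. (x \<bullet> i) *\<^sub>R i) (\<Sum>j\<in>Basis. (y \<bullet> j) *\<^sub>R j)"
    by (simp add: euclidean_representation)
  also have "\<dots> = (\<Sum>i\<in>Basis. (x \<bullet> i) * b i (\<Sum>j\<in>Basis. (y \<bullet> j) *\<^sub>R j))"
    by (simp only: linear_sum[OF l(1)] linear_scale[OF l(1)] real_scaleR_def)
  also have "\<dots> = (\<Sum>i\<in>Basis. \<Sum>j\<in>Basis. (x \<bullet> i) * (y \<bullet> j) * b i j)"
    by (simp only: linear_sum[OF l(2)] linear_scale[OF l(2)] real_scaleR_def sum_distrib_left mult.assoc)
  finally show ?thesis .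
qed

lemma nondegenerate_eqI:
  assumes "bilinear b" "nondegenerate b" "\<And>z. b u z = b v z"
  shows "u = v"
proof -
  have "b (u - v) z = 0" for z using assms(3) bilinear_lsub[OF assms(1)] by simp
  then show ?thesis using assms(2) unfolding nondegenerate_def by (metis right_minus_eq)
qed

text \<open>In finite dimension the injective map into the dual given by a nondegenerate form is
  onto; \<open>T\<close> is this map, with the dual identified with the space through the standard
  basis.\<close>

lemma nondegenerate_represents:
  fixes b :: "'a::euclidean_space \<Rightarrow> 'a \<Rightarrow> real"
  assumes b: "bilinear b" "nondegenerate b" and l: "linear l"
  obtains w where "\<And>z. b w z = l z"
proof -
  have lb: "linear (\<lambda>x. b x y)" "linear (b x)" for x y using b by (auto simp: bilinear_def)
  define T where "T w = (\<Sum>i\<in>Basis. b w i *\<^sub>R i)" for w :: 'a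
  have eq: "k z = k' z" if "linear k" "linear k'" "\<forall>i\<in>Basis. k i = k' i" for k k' :: "'a \<Rightarrow> real" and z
    using linear_eq_stdbasis[OF that(1,2)] that(3) by metis
  have T: "linear T" unfolding T_def
    by (intro linear_compose_sum ballI linearI)
      (simp_all add: linear_add[OF lb(1)] linear_scale[OF lb(1)] scaleR_add_left)
  have Ti: "T w \<bullet> i = b w i" if "i \<in> Basis" for w i using that by (simp add: T_def inner_sum_left inner_Basis if_distrib sum.delta cong: if_cong)
  have "inj T"
  proof (rule linear_injective_0[OF T, THEN iffD2], intro allI impI)
    fix w assume "T w = 0"
    then have "\<forall>i\<in>Basis. b w i = 0" using Ti by (metis inner_zero_left)
    then have "b w z = 0" for z using eq[OF lb(2) linear_zero] by simp
    then show "w = 0" using b(2) by (auto simp: nondegenerate_def)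
  qed
  then have "surj T" using T linear_injective_imp_surjective by blast
  then obtain w where w: "T w = (\<Sum>i\<in>Basis. l i *\<^sub>R i)" by (metis surjD)
  have "b w i = l i" if "i \<in> Basis" for i
    using that Ti[OF that, of w] unfolding w by (simp add: inner_sum_left inner_Basis if_distrib sum.delta cong: if_cong)
  then show ?thesis using that eq[OF lb(2) l] by blast
qed

text \<open>\<open>levi_civita_symbol\<close> is a definite description, so existence and uniqueness
  are both required. Torsion-freeness and three instances of metric compatibility give the Koszul
  formula, hence uniqueness; representing its right-hand side through \<open>g p\<close> gives
  existence.\<close>

lemma levi_civita_symbol_koszul:
  fixes g :: "'a::euclidean_space \<Rightarrow> 'a \<Rightarrow> 'a \<Rightarrow> real"
  assumes U: "open U" "p \<in> U"
    and bil: "\<And>q. q \<in> U \<Longrightarrow> bilinear (g q)"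
    and sym: "\<And>q x y. q \<in> U \<Longrightarrow> g q x y = g q y x"
    and nd: "nondegenerate (g p)"
    and dg: "\<And>x y. ((\<lambda>q. g q x y) has_derivative dg x y) (at p)"
  shows "2 * g p (levi_civita_symbol g p x y) z = dg y z x + dg x z y - dg x y z"
proof -
  note bp = bil[OF U(2)]
  have g_sum: "(\<Sum>i\<in>Basis. \<Sum>j\<in>Basis. (x \<bullet> i) * (y \<bullet> j) * g q i j) = g q x y"
    if "q \<in> U" for q x y
    by (rule bilinear_eq_sum_Basis[OF bil[OF that], symmetric])
  \<comment> \<open>\<open>dg\<close> is given separately for each pair of vectors; its bilinearity
    is obtained by differentiating the basis expansion of \<open>g q\<close>.\<close>
  have dg_sum: "dg x y h = (\<Sum>i\<in>Basis. \<Sum>j\<in>Basis. (x \<bullet> i) * (y \<bullet> j) * dg i j h)" for x y h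
  proof -
    have "((\<lambda>q. \<Sum>i\<in>Basis. \<Sum>j\<in>Basis. (x \<bullet> i) * (y \<bullet> j) * g q i j) has_derivative
       (\<lambda>h. \<Sum>i\<in>Basis. \<Sum>j\<in>Basis. (x \<bullet> i) * (y \<bullet> j) * dg i j h)) (at p)"
      by (intro has_derivative_sum has_derivative_mult_right dg)
    then have "((\<lambda>q. g q x y) has_derivative
       (\<lambda>h. \<Sum>i\<in>Basis. \<Sum>j\<in>Basis. (x \<bullet> i) * (y \<bullet> j) * dg i j h)) (at p)"
      by (rule has_derivative_transform_within_open[OF _ U]) (simp only: g_sum)
    from has_derivative_unique[OF dg this] show ?thesis by (rule fun_cong)
  qed
  have dg_bil: "bilinear (\<lambda>x y. dg x y h)" for h
  proof -
    have "linear (\<lambda>x. \<Sum>i\<in>Basis. \<Sum>j\<in>Basis. (x \<bullet> i) * (y \<bullet> j) * dg i j h)"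
      "linear (\<lambda>y. \<Sum>i\<in>Basis. \<Sum>j\<in>Basis. (x \<bullet> i) * (y \<bullet> j) * dg i j h)" for x y
      by (intro linear_compose_sum ballI linearI; simp add: inner_add_left algebra_simps)+
    then show ?thesis unfolding bilinear_def dg_sum[symmetric] by blast
  qed
  have dg_lin: "linear (dg x y)" for x y using dg has_derivative_linear by blast
  have dg_sym: "dg x y = dg y x" for x y
  proof -
    have "((\<lambda>q. g q y x) has_derivative dg x y) (at p)"
      by (rule has_derivative_transform_within_open[OF dg U]) (simp add: sym)
    then show ?thesis using dg has_derivative_unique by blast
  qed
  \<comment> \<open>Passes from constant to variable fields, over which the description of the
    symbol quantifies.\<close>
  have product_rule: "((\<lambda>q. g q (Y q) (Z q)) has_derivative
      (\<lambda>h. dg (Y p) (Z p) h + g p (Y' h) (Z p) + g p (Y p) (Z' h))) (at p)"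
    if Y: "(Y has_derivative Y') (at p)" and Z: "(Z has_derivative Z') (at p)" for Y Z Y' Z'
  proof -
    have "((\<lambda>q. \<Sum>i\<in>Basis. \<Sum>j\<in>Basis. (Y q \<bullet> i) * (Z q \<bullet> j) * g q i j) has_derivative
      (\<lambda>h. \<Sum>i\<in>Basis. \<Sum>j\<in>Basis. (Y p \<bullet> i) * (Z p \<bullet> j) * dg i j h +
         ((Y p \<bullet> i) * (Z' h \<bullet> j) + (Y' h \<bullet> i) * (Z p \<bullet> j)) * g p i j)) (at p)"
      by (intro has_derivative_sum has_derivative_mult has_derivative_inner_left dg Y Z)
    moreover have "(\<Sum>i\<in>Basis. \<Sum>j\<in>Basis. (Y p \<bullet> i) * (Z p \<bullet> j) * dg i j h +
         ((Y p \<bullet> i) * (Z' h \<bullet> j) + (Y' h \<bullet> i) * (Z p \<bullet> j)) * g p i j)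
       = dg (Y p) (Z p) h + g p (Y' h) (Z p) + g p (Y p) (Z' h)" for h
      unfolding dg_sum[of "Y p"] bilinear_eq_sum_Basis[OF bp, of "Y p"] bilinear_eq_sum_Basis[OF bp, of "Y' h"]
      by (simp add: sum.distrib[symmetric] algebra_simps)
    ultimately have "((\<lambda>q. \<Sum>i\<in>Basis. \<Sum>j\<in>Basis. (Y q \<bullet> i) * (Z q \<bullet> j) * g q i j) has_derivative
      (\<lambda>h. dg (Y p) (Z p) h + g p (Y' h) (Z p) + g p (Y p) (Z' h))) (at p)" by simp
    then show ?thesis
      by (rule has_derivative_transform_within_open[OF _ U]) (simp only: g_sum)
  qed
  let ?P = "\<lambda>\<Gamma>. bilinear \<Gamma> \<and>
     (\<forall>X Y Z. X differentiable (at p) \<longrightarrow> Y differentiable (at p) \<longrightarrow> Z differentiable (at p) \<longrightarrow>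
        cov_deriv \<Gamma> X Y p - cov_deriv \<Gamma> Y X p = lie_bracket X Y p \<and>
        frechet_derivative (\<lambda>q. g q (Y q) (Z q)) (at p) (X p) =
          g p (cov_deriv \<Gamma> X Y p) (Z p) + g p (Y p) (cov_deriv \<Gamma> X Z p))"
  have koszul: "2 * g p (\<Gamma> x y) z = dg y z x + dg x z y - dg x y z" if P: "?P \<Gamma>" for \<Gamma> x y z
  proof -
    \<comment> \<open>Constant fields have zero derivative and zero bracket, so
      \<open>cov_deriv\<close> reduces to \<open>\<Gamma>\<close>.\<close>
    have tf: "\<Gamma> x y = \<Gamma> y x" for x y
      using conjunct2[OF P, rule_format, of "\<lambda>_. x" "\<lambda>_. y" "\<lambda>_. 0"] by (simp add: cov_deriv_def lie_bracket_def)
    have m: "dg y z x = g p (\<Gamma> x y) z + g p y (\<Gamma> x z)" for x y z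
      using conjunct2[OF P, rule_format, of "\<lambda>_. x" "\<lambda>_. y" "\<lambda>_. z"]
      by (simp add: cov_deriv_def frechet_derivative_at[OF dg, symmetric])
    show ?thesis
      unfolding m[of y z x] m[of x z y] m[of x y z] tf[of y x] tf[of z x] tf[of z y] sym[OF U(2), of y]
      by simp
  qed
  have ex_w: "\<exists>w. \<forall>z. g p w z = (dg y z x + dg x z y - dg x y z) / 2" for x y
  proof -
    have l1: "linear (\<lambda>z. dg y z x)" for x y using dg_bil by (auto simp: bilinear_def)
    have "linear (\<lambda>z. (1/2) *\<^sub>R (dg y z x + dg x z y - dg x y z))"
      by (intro linear_compose_scale_right linear_compose_add linear_compose_sub l1 dg_lin)
    from nondegenerate_represents[OF bp nd this] obtain w
      where "\<And>z. g p w z = (1/2) *\<^sub>R (dg y z x + dg x z y - dg x y z)" by blast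
    then show ?thesis by auto
  qed
  define \<Gamma> where "\<Gamma> x y = (SOME w. \<forall>z. g p w z = (dg y z x + dg x z y - dg x y z) / 2)" for x y
  have \<Gamma>: "g p (\<Gamma> x y) z = (dg y z x + dg x z y - dg x y z) / 2" for x y z
    using someI_ex[OF ex_w] unfolding \<Gamma>_def by blast
  have lin1: "dg (x + x') y h = dg x y h + dg x' y h" "dg y (x + x') h = dg y x h + dg y x' h"
     "dg (r *\<^sub>R x) y h = r * dg x y h" "dg y (r *\<^sub>R x) h = r * dg y x h"
     "dg x y (h + k) = dg x y h + dg x y k" "dg x y (r *\<^sub>R h) = r * dg x y h" for x x' y h k r
    using bilinear_ladd[OF dg_bil] bilinear_radd[OF dg_bil] bilinear_lmul[OF dg_bil] bilinear_rmul[OF dg_bil]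
      linear_add[OF dg_lin] linear_scale[OF dg_lin] by simp_all
  have "bilinear \<Gamma>"
    unfolding bilinear_def
    by (intro conjI allI linearI; rule nondegenerate_eqI[OF bp nd])
      (simp_all add: \<Gamma> bilinear_ladd[OF bp] bilinear_lmul[OF bp] lin1 field_simps)
  moreover have "\<Gamma> x y = \<Gamma> y x" for x y
    by (rule nondegenerate_eqI[OF bp nd]) (simp add: \<Gamma> dg_sym[of x y])
  moreover have "frechet_derivative (\<lambda>q. g q (Y q) (Z q)) (at p) (X p) =
          g p (cov_deriv \<Gamma> X Y p) (Z p) + g p (Y p) (cov_deriv \<Gamma> X Z p)"
    if "Y differentiable (at p)" "Z differentiable (at p)" for X Y Z
  proof -
    \<comment> \<open>In the sum of the two Koszul expressions everything cancels except the
      derivative along \<open>X p\<close>.\<close>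
    have "g p (\<Gamma> (X p) (Y p)) (Z p) + g p (Y p) (\<Gamma> (X p) (Z p)) = dg (Y p) (Z p) (X p)"
      unfolding sym[OF U(2), of "Y p"] \<Gamma> by (simp add: dg_sym[of "Z p" "Y p"] field_simps)
    then show ?thesis
      using that unfolding frechet_derivative_works
      by (simp add: frechet_derivative_at[OF product_rule, symmetric] cov_deriv_def bilinear_ladd[OF bp] bilinear_radd[OF bp])
  qed
  ultimately have ex: "?P \<Gamma>" by (simp add: cov_deriv_def lie_bracket_def)
  have "?P (levi_civita_symbol g p)"
    unfolding levi_civita_symbol_def
  proof (rule theI[where P = ?P, OF ex])
    fix \<Gamma>' assume P': "?P \<Gamma>'"
    have "\<Gamma>' x y = \<Gamma> x y" for x y
    proof (rule nondegenerate_eqI[OF bp nd])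
      fix z show "g p (\<Gamma>' x y) z = g p (\<Gamma> x y) z" using koszul[OF P', of x y z] koszul[OF ex, of x y z] by simp
    qed
    then show "\<Gamma>' = \<Gamma>" by blast
  qed
  then show ?thesis by (rule koszul)
qed

section \<open>Symmetries of order three\<close>

lemma comp_in_special_isometry_group:
  assumes "L \<in> carrier (special_isometry_group b)" "M \<in> carrier (special_isometry_group b)"
  shows "L \<circ> M \<in> carrier (special_isometry_group b)"
  using assms by (auto simp: special_isometry_group_def linear_compose matrix_compose det_mul)

lemma monoid_special_isometry_group: "Group.monoid (special_isometry_group b)"
  by (rule monoidI)
    (auto simp: special_isometry_group_def linear_compose matrix_compose det_mul comp_assoc
      linear_id matrix_id_mat_1[unfolded id_def[symmetric]])

text \<open>The elements \<open>id\<close>, \<open>L\<close> and \<open>L \<circ> L\<close> are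
  distinct, since any coincidence together with \<open>L3\<close> would give \<open>L = id\<close>;
  they form a cyclic group of order three, and equivariance passes from \<open>L\<close> to its
  square.\<close>

lemma symmetry_at_Z3I:
  fixes L :: "real^'n \<Rightarrow> real^'n"
  assumes L: "L \<in> carrier (special_isometry_group (affine_metric \<phi> \<xi> p))"
    and L3: "L \<circ> L \<circ> L = id" and Lid: "L \<noteq> id"
    and equiv: "\<And>x y. difference_tensor \<phi> \<xi> p (L x) (L y) = L (difference_tensor \<phi> \<xi> p x y)"
  shows "symmetry_at \<phi> \<xi> p Z3"
proof -
  define G where "G = special_isometry_group (affine_metric \<phi> \<xi> p)"
  interpret Group.monoid G unfolding G_def by (rule monoid_special_isometry_group)
  have [simp]: "x \<otimes>\<^bsub>G\<^esub> y = x \<circ> y" "\<one>\<^bsub>G\<^esub> = id" for x y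
    by (simp_all add: G_def special_isometry_group_def)
  define H where "H = {id, L, L \<circ> L}"
  have L3': "L (L (L x)) = x" for x using L3 by (metis comp_apply id_apply)
  have LL: "L \<circ> L \<noteq> id" "L \<circ> L \<noteq> L" using L3 Lid by (metis comp_id comp_assoc id_comp)+
  have HG: "H \<subseteq> carrier G"
    using L comp_in_special_isometry_group[OF L L] one_closed by (auto simp: H_def G_def special_isometry_group_def)
  have inv: "inv\<^bsub>G\<^esub> x \<in> H" if "x \<in> H" for x
  proof -
    have "\<exists>y\<in>H. x \<circ> y = id \<and> y \<circ> x = id" using that L3 by (auto simp: H_def comp_assoc)
    then obtain y where "y \<in> H" "x \<circ> y = id" "y \<circ> x = id" by blast
    then show ?thesis using inv_unique'[of x y] that HG by auto
  qed
  have "subgroup H G"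
    by (rule subgroup.intro) (use HG inv in \<open>auto simp: H_def fun_eq_iff L3'\<close>)
  moreover have "G\<lparr>carrier := H\<rparr> \<cong> Z3"
  proof (rule is_isoI)
    \<comment> \<open>The exponent of \<open>L\<close>, taken modulo 3.\<close>
    let ?h = "\<lambda>M. if M = id then 0 else if M = L then 1 else 2 :: int"
    have "?h \<in> hom (G\<lparr>carrier := H\<rparr>) Z3"
      using L3 LL Lid by (auto simp: hom_def H_def carrier_integer_mod_group comp_assoc)
    moreover have "{0..<3} = {0, 1, 2::int}" by auto
    then have "bij_betw ?h H (carrier Z3)"
      using LL Lid by (auto simp: bij_betw_def inj_on_def H_def carrier_integer_mod_group)
    ultimately show "?h \<in> iso (G\<lparr>carrier := H\<rparr>) Z3" by (simp add: iso_def)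
  qed
  moreover have "\<forall>M\<in>H. \<forall>x y. difference_tensor \<phi> \<xi> p (M x) (M y) = M (difference_tensor \<phi> \<xi> p x y)"
    by (auto simp: H_def equiv)
  ultimately show ?thesis unfolding symmetry_at_def G_def by blast
qed

section \<open>Rotations of a Euclidean plane preserving a traceless cubic form\<close>

lemma bilinear_vec2:
  fixes h :: "real^2 \<Rightarrow> real^2 \<Rightarrow> real"
  assumes "bilinear h"
  shows "h x y = x$1 * (y$1 * h (axis 1 1) (axis 1 1) + y$2 * h (axis 1 1) (axis 2 1))
    + x$2 * (y$1 * h (axis 2 1) (axis 1 1) + y$2 * h (axis 2 1) (axis 2 1))"
proof -
  have e: "x = x$1 *\<^sub>R axis 1 1 + x$2 *\<^sub>R axis 2 1" for x :: "real^2"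
    by (simp add: vec_eq_iff forall_2 axis_def)
  show ?thesis
    by (subst e[of x], subst e[of y])
      (simp only: bilinear_ladd[OF assms] bilinear_radd[OF assms] bilinear_lmul[OF assms] bilinear_rmul[OF assms]
        real_scaleR_def algebra_simps)
qed

text \<open>With \<open>J\<close> the complex structure of the metric \<open>h\<close>, tracelessness of the cubic form \<open>C\<close> means
  \<open>C(Jx, Jy, z) = - C(x, y, z)\<close>, so that \<open>C\<close> is the real part of a multiple of \<open>z\<^sup>3\<close>; the
  rotation is \<open>R = - 1/2 + (sqrt 3 / 2) J\<close>.\<close>

lemma traceless_cubic_rotation:
  fixes h :: "real^2 \<Rightarrow> real^2 \<Rightarrow> real" and C :: "real^2 \<Rightarrow> real^2 \<Rightarrow> real^2 \<Rightarrow> real"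
  defines "e \<equiv> (\<lambda>i. axis i 1 :: real^2)"
  assumes h: "bilinear h" "h (e 2) (e 1) = h (e 1) (e 2)"
    and det: "h (e 1) (e 1) * h (e 2) (e 2) - (h (e 1) (e 2))\<^sup>2 = 1"
    and C: "\<And>z. bilinear (C z)" "\<And>x y z. C x y z = C y x z" "\<And>x y z. C x y z = C x z y"
    and traceless: "\<And>z. C z (e 1) (e 1) * h (e 2) (e 2) + h (e 1) (e 1) * C z (e 2) (e 2)
       = 2 * h (e 1) (e 2) * C z (e 1) (e 2)"
  obtains R where "linear R" "R \<noteq> id" "\<And>x. R (R (R x)) = x"
    "\<And>x y. h (R x) (R y) = h x y" "\<And>x y z. C (R x) (R y) (R z) = C x y z"
    "R (e 1) $ 1 * R (e 2) $ 2 - R (e 1) $ 2 * R (e 2) $ 1 = 1"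
proof -
  define a b d where "a = h (e 1) (e 1)" and "b = h (e 1) (e 2)" and "d = h (e 2) (e 2)"
  define p q r s where "p = C (e 1) (e 1) (e 1)" and "q = C (e 1) (e 1) (e 2)"
    and "r = C (e 1) (e 2) (e 2)" and "s = C (e 2) (e 2) (e 2)"
  have hx: "h x y = x$1 * (y$1 * a + y$2 * b) + x$2 * (y$1 * b + y$2 * d)" for x y
    using bilinear_vec2[OF h(1), of x y] h(2) by (simp add: a_def b_def d_def e_def)
  have det': "a * d - b * b = 1" using det by (simp add: a_def b_def d_def power2_eq_square)
  \<comment> \<open>By total symmetry the cubic form has only the four coefficients
    \<open>p\<close>, \<open>q\<close>, \<open>r\<close>, \<open>s\<close>.\<close>
  have Cz: "C z x y = z$1 * (x$1 * (y$1 * p + y$2 * q) + x$2 * (y$1 * q + y$2 * r))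
      + z$2 * (x$1 * (y$1 * q + y$2 * r) + x$2 * (y$1 * r + y$2 * s))" for x y z
  proof -
    have sw: "C (e 1) (e 2) (e 1) = q" "C (e 2) (e 1) (e 1) = q" "C (e 2) (e 1) (e 2) = r"
      "C (e 2) (e 2) (e 1) = r" unfolding q_def r_def by (metis C(2,3))+
    have "C z x y = x$1 * (y$1 * C z (e 1) (e 1) + y$2 * C z (e 1) (e 2))
       + x$2 * (y$1 * C z (e 2) (e 1) + y$2 * C z (e 2) (e 2))"
      using bilinear_vec2[OF C(1), of z x y] by (simp add: e_def)
    moreover have "C z u v = z$1 * C (e 1) u v + z$2 * C (e 2) u v" for u v
    proof -
      have rot: "C z u v = C u v z" for z by (simp only: C(2)[of z u v] C(3)[of u z v])
      have "z = z$1 *\<^sub>R e 1 + z$2 *\<^sub>R e 2" by (simp add: e_def vec_eq_iff forall_2 axis_def)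
      then have "C u v z = C u v (z$1 *\<^sub>R e 1 + z$2 *\<^sub>R e 2)" by simp
      then show ?thesis
        unfolding rot bilinear_radd[OF C(1)] bilinear_rmul[OF C(1)] by simp
    qed
    ultimately show ?thesis using sw by (simp add: p_def q_def r_def s_def algebra_simps)
  qed
  \<comment> \<open>The trace of \<open>C z\<close> with respect to \<open>h\<close>: as the Gram
    determinant is 1, the inverse Gram matrix has diagonal \<open>d\<close>, \<open>a\<close> and
    off-diagonal entry \<open>- b\<close>.\<close>
  have t1: "p * d + a * r = 2 * b * q" and t2: "q * d + a * s = 2 * b * r"
    using traceless[of "e 1"] traceless[of "e 2"] C(2,3) unfolding a_def b_def d_def p_def q_def r_def s_def by metis+
  \<comment> \<open>The quarter turn of \<open>h\<close>, determined by
    \<open>h (J x) y = x$1 * y$2 - x$2 * y$1\<close>; no normalizing factor occurs because the Gram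
    determinant is 1.\<close>
  define J :: "real^2 \<Rightarrow> real^2" where "J x = vector [- b * x$1 - d * x$2, a * x$1 + b * x$2]" for x
  have JJ: "J (J x) = - x" for x
    using det' by (simp add: J_def vec_eq_iff forall_2) (safe; algebra)
  have CJ: "C (J x) (J y) z = - C x y z" for x y z
  proof -
    have "b * b * p - 2 * a * b * q + a * a * r = - p" "b * b * q - 2 * a * b * r + a * a * s = - q"
      "b * d * p - (a * d + b * b) * q + a * b * r = - q" "b * d * q - (a * d + b * b) * r + a * b * s = - r"
      "d * d * p - 2 * b * d * q + b * b * r = - r" "d * d * q - 2 * b * d * r + b * b * s = - s"
      using t1 t2 det' by algebra+
    then show ?thesis unfolding Cz J_def vector_2 by algebra
  qed
  have hJ: "h (J x) (J y) = h x y" for x y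
    using det' unfolding hx J_def vector_2 by algebra
  have hJ': "h (J x) y = - h x (J y)" for x y
    by (simp add: hx J_def algebra_simps)
  have linJ: "linear J" by (rule linearI) (simp_all add: J_def vec_eq_iff forall_2 algebra_simps)
  have C_lin: "C (u + v) y z = C u y z + C v y z" "C y (u + v) z = C y u z + C y v z" "C y z (u + v) = C y z u + C y z v"
    "C (k *\<^sub>R u) y z = k * C u y z" "C y (k *\<^sub>R u) z = k * C y u z" "C y z (k *\<^sub>R u) = k * C y z u" for u v y z k
    unfolding Cz by (simp_all add: algebra_simps)
  have h_lin: "h (u + v) y = h u y + h v y" "h y (u + v) = h y u + h y v"
    "h (k *\<^sub>R u) y = k * h u y" "h y (k *\<^sub>R u) = k * h y u" for u v y k
    unfolding hx by (simp_all add: algebra_simps)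
  define m where "m = sqrt 3 / 2"
  have m: "m * m = 3/4" by (simp add: m_def)
  define R where "R x = (-1/2) *\<^sub>R x + m *\<^sub>R J x" for x
  have linR: "linear R" unfolding R_def by (intro linear_compose_add linear_compose_scale_right linJ linear_ident)
  have RR: "R (R x) = (-1/2) *\<^sub>R x - m *\<^sub>R J x" for x
    using m unfolding R_def linear_add[OF linJ] linear_scale[OF linJ] JJ
    by (simp add: vec_eq_iff field_simps)
  have R3: "R (R (R x)) = x" for x
  proof -
    have "J (R x) = (-1/2) *\<^sub>R J x - m *\<^sub>R x"
      unfolding R_def linear_add[OF linJ] linear_scale[OF linJ] JJ by simp
    then have "R (R (R x)) = (-1/2) *\<^sub>R ((-1/2) *\<^sub>R x + m *\<^sub>R J x) - m *\<^sub>R ((-1/2) *\<^sub>R J x - m *\<^sub>R x)"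
      unfolding RR[of "R x"] by (simp add: R_def)
    then show ?thesis using m by (simp add: vec_eq_iff field_simps)
  qed
  have hR: "h (R x) (R y) = h x y" for x y
    unfolding R_def h_lin unfolding hJ unfolding hJ' using m by algebra
  \<comment> \<open>\<open>J\<close> can be moved between the arguments of \<open>C\<close>. After
    expansion the coefficient of \<open>C x y z\<close> is -1/8 + 9/8 = 1, and that of
    \<open>C (J x) y z\<close> is \<open>3/4 * m - m^3 = 0\<close>: the cube of a third root of
    unity.\<close>
  have CR: "C (R x) (R y) (R z) = C x y z" for x y z
  proof -
    have 1: "C x (J y) z = C (J x) y z" for x y z
      using CJ[of "J x" y z] JJ C_lin(4)[of "-1"] by simp
    have 2: "C x y (J z) = C (J x) y z" using 1 C(2,3) by metis
    have 3: "C x (J y) (J z) = - C x y z" "C (J x) y (J z) = - C x y z" using CJ C(2,3) by metis+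
    show ?thesis unfolding R_def C_lin unfolding CJ 3 unfolding 1 2 using m by algebra
  qed
  \<comment> \<open>\<open>J\<close> has trace 0 and determinant \<open>a * d - b * b\<close>, so no
    term linear in \<open>m\<close> survives.\<close>
  have "R (e 1) $ 1 * R (e 2) $ 2 - R (e 1) $ 2 * R (e 2) $ 1 = 1/4 + (m * m) * (a * d - b * b)"
    by (simp add: R_def J_def e_def axis_def algebra_simps)
  then have "R (e 1) $ 1 * R (e 2) $ 2 - R (e 1) $ 2 * R (e 2) $ 1 = 1"
    using m det' by simp
  moreover have "R \<noteq> id"
  proof
    assume "R = id"
    then have "R (e 1) $ 1 * R (e 2) $ 2 = 1" "R (e 1) $ 2 * R (e 2) $ 1 = 0" "R (e 1) $ 1 = 1" "R (e 2) $ 2 = 1"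
      by (simp_all add: e_def axis_def)
    then show False by (simp add: R_def J_def e_def axis_def)
  qed
  ultimately show ?thesis using that linR R3 hR CR by blast
qed

section \<open>Affine hypersurfaces\<close>

lemma has_derivative_vector_4:
  assumes "(w has_derivative w') (at p)" "(x has_derivative x') (at p)"
    "(y has_derivative y') (at p)" "(z has_derivative z') (at p)"
  shows "((\<lambda>q. vector [w q, x q, y q, z q] :: real^4) has_derivative (\<lambda>h. vector [w' h, x' h, y' h, z' h])) (at p)"
proof -
  have e: "vector [w, x, y, z] = w *\<^sub>R axis 1 1 + x *\<^sub>R axis 2 1 + y *\<^sub>R axis 3 1 + z *\<^sub>R (axis 4 1 :: real^4)" for w x y z
    by (simp add: vec_eq_iff forall_4 axis_def)
  show ?thesis unfolding e by (intro has_derivative_add has_derivative_scaleR_left assms)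
qed

lemma immersed_hypersurface_push:
  assumes "immersed_hypersurface U \<phi>" "p \<in> U"
  shows "linear (push \<phi> p)" "inj (push \<phi> p)"
  using assms smooth_on_differentiable[of U \<phi> p "[]"]
  by (auto simp: immersed_hypersurface_def intro: linear_frechet_derivative)

text \<open>Different coefficients of \<open>\<xi> p\<close> would make it a pushed-forward tangent
  vector. This uniqueness gives the definite descriptions \<open>tang_part\<close> and
  \<open>transv_part\<close> their values.\<close>

lemma hypersurface_decomposition_unique:
  assumes "immersed_hypersurface U \<phi>" "p \<in> U" "\<xi> p \<notin> range (push \<phi> p)"
    and "push \<phi> p x + c *\<^sub>R \<xi> p = push \<phi> p x' + c' *\<^sub>R \<xi> p"
  shows "x = x' \<and> c = c'"
proof -
  note lin = immersed_hypersurface_push[OF assms(1,2)]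
  have eq: "(c - c') *\<^sub>R \<xi> p = push \<phi> p (x' - x)"
    using assms(4) by (simp add: linear_diff[OF lin(1)] algebra_simps)
  have "c = c'"
  proof (rule ccontr)
    assume c: "c \<noteq> c'"
    have "\<xi> p = (1 / (c - c')) *\<^sub>R ((c - c') *\<^sub>R \<xi> p)" using c by simp
    also have "\<dots> = push \<phi> p ((1 / (c - c')) *\<^sub>R (x' - x))" unfolding eq linear_scale[OF lin(1)] ..
    finally show False using assms(3) by blast
  qed
  then show ?thesis using assms(4) lin(2) by (simp add: inj_eq)
qed

lemma tang_transv_part_eqI:
  assumes "immersed_hypersurface U \<phi>" "p \<in> U" "\<xi> p \<notin> range (push \<phi> p)"
    and "u = push \<phi> p x + c *\<^sub>R \<xi> p"
  shows "tang_part \<phi> \<xi> p u = x" "transv_part \<phi> \<xi> p u = c"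
  unfolding tang_part_def transv_part_def
  using assms(4) hypersurface_decomposition_unique[where \<xi> = \<xi>, OF assms(1-3)] by (blast intro!: the_equality)+

text \<open>A dimension count: the image of the injective \<open>push \<phi> p\<close> has
  codimension one and misses \<open>\<xi> p\<close>.\<close>

lemma hypersurface_decomposition:
  fixes \<phi> :: "real^'n \<Rightarrow> real^'m"
  assumes "immersed_hypersurface U \<phi>" "p \<in> U" "\<xi> p \<notin> range (push \<phi> p)"
  shows "u = push \<phi> p (tang_part \<phi> \<xi> p u) + transv_part \<phi> \<xi> p u *\<^sub>R \<xi> p"
proof -
  note lin = immersed_hypersurface_push[OF assms(1,2)]
  have sub: "span (range (push \<phi> p)) = range (push \<phi> p)"
    using linear_subspace_image[OF lin(1) subspace_UNIV] by (simp add: span_eq_iff)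
  have "dim (range (push \<phi> p)) = CARD('n)"
    using dim_image_eq[OF lin(1), of UNIV] lin(2) by simp
  then have "dim (insert (\<xi> p) (range (push \<phi> p))) = DIM(real^'m)"
    using assms by (simp add: dim_insert sub immersed_hypersurface_def)
  then have "u \<in> span (insert (\<xi> p) (range (push \<phi> p)))"
    using dim_eq_full by blast
  then obtain c x where "u - c *\<^sub>R \<xi> p = push \<phi> p x" unfolding span_breakdown_eq sub by blast
  then have u: "u = push \<phi> p x + c *\<^sub>R \<xi> p" by (simp add: algebra_simps)
  show ?thesis unfolding tang_transv_part_eqI[where \<xi> = \<xi>, OF assms u] by (rule u)
qed

text \<open>On the line every direction is a multiple of 1, so lists of ones in
  \<open>iter_deriv\<close> yield the ordinary higher derivatives.\<close>

lemma smooth_on_component_derivative: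
  fixes \<gamma> :: "real \<Rightarrow> real^'n"
  assumes "smooth_on I \<gamma>" "open I" "t \<in> I"
  shows "((\<lambda>t. iter_deriv vs \<gamma> t $ i) has_real_derivative iter_deriv (1 # vs) \<gamma> t $ i) (at t)"
proof -
  have "(\<lambda>h. iter_deriv (h # vs) \<gamma> t $ i) = (*) (iter_deriv (1 # vs) \<gamma> t $ i)"
  proof
    fix h :: real
    show "iter_deriv (h # vs) \<gamma> t $ i = iter_deriv (1 # vs) \<gamma> t $ i * h"
      using linear_scale[OF smooth_on_iter_deriv_linear[OF assms, of "[]"], of h 1 vs] by simp
  qed
  then show ?thesis
    using bounded_linear.has_derivative[OF bounded_linear_vec_nth smooth_on_has_derivative[OF assms, of vs], of i]
    unfolding has_field_derivative_def by argo
qed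

lemma frechet_derivative_vec_nth: "frechet_derivative (\<lambda>q::real^'n. q $ i) (at p) = (\<lambda>h. h $ i)"
  by (rule frechet_derivative_at[symmetric]) (rule bounded_linear_imp_has_derivative[OF bounded_linear_vec_nth])

text \<open>Second derivatives of a graph are vertical, so the affine metric is the Hessian of
  \<open>f\<close>. The frame of the two coordinate tangents and the normal has determinant 1, which
  turns the volume condition into a Monge-Ampere equation up to sign.\<close>

lemma improper_graph_surface:
  fixes f :: "real^2 \<Rightarrow> real"
  defines "e \<equiv> (\<lambda>i. axis i 1 :: real^2)"
  assumes normal: "affine_normal N (graph_surface f) (\<lambda>_. vector [0, 0, 1])"
  shows "open N" "smooth_on N f"
    and "x \<in> N \<Longrightarrow> affine_metric (graph_surface f) (\<lambda>_. vector [0, 0, 1]) x u v = iter_deriv [u, v] f x"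
    and "x \<in> N \<Longrightarrow> \<bar>iter_deriv [e 1, e 1] f x * iter_deriv [e 2, e 2] f x - (iter_deriv [e 1, e 2] f x)\<^sup>2\<bar> = 1"
proof -
  let ?\<psi> = "graph_surface f" and ?n = "vector [0, 0, 1] :: real^3"
  have im: "immersed_hypersurface N ?\<psi>" using normal by (simp add: affine_normal_def)
  then show o: "open N" by (simp add: immersed_hypersurface_def)
  have sm: "smooth_on N ?\<psi>" using im by (simp add: immersed_hypersurface_def)
  have comp: "iter_deriv vs ?\<psi> x $ i = iter_deriv vs (\<lambda>q. ?\<psi> q $ i) x" if "x \<in> N" for vs x i
    using iter_deriv_bounded_linear[OF bounded_linear_vec_nth sm o that] by simp
  have f: "(\<lambda>q. ?\<psi> q $ 3) = f" by (simp add: graph_surface_def)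
  have \<psi>12: "(\<lambda>q. ?\<psi> q $ 1) = (\<lambda>q. q $ 1)" "(\<lambda>q. ?\<psi> q $ 2) = (\<lambda>q. q $ 2)" by (simp_all add: graph_surface_def)
  show smf: "smooth_on N f"
    using smooth_on_bounded_linear[OF bounded_linear_vec_nth sm o, of 3] f by simp
  have d1: "push ?\<psi> x v = vector [v$1, v$2, iter_deriv [v] f x]" if "x \<in> N" for x v
    using comp[OF that, of "[v]"] by (simp add: vec_eq_iff forall_3 f \<psi>12 frechet_derivative_vec_nth)
  have d2: "flat_deriv ?\<psi> (\<lambda>_. u) (\<lambda>_. v) x = iter_deriv [u, v] f x *\<^sub>R ?n" if "x \<in> N" for x u v
    using comp[OF that, of "[u, v]"] by (simp add: flat_deriv_def vec_eq_iff forall_3 f \<psi>12 frechet_derivative_vec_nth)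
  have metric: "affine_metric ?\<psi> (\<lambda>_. ?n) x u v = iter_deriv [u, v] f x" if "x \<in> N" for x u v
  proof -
    have "?n \<notin> range (push ?\<psi> x)" using normal that by (auto simp: affine_normal_def)
    then show ?thesis
      unfolding affine_metric_def
      by (intro tang_transv_part_eqI(2)[where \<xi> = "\<lambda>_. ?n" and x = 0, OF im that])
        (simp_all add: d2[OF that] linear_0[OF immersed_hypersurface_push(1)[OF im that]])
  qed
  then show "x \<in> N \<Longrightarrow> affine_metric ?\<psi> (\<lambda>_. ?n) x u v = iter_deriv [u, v] f x" .
  assume x: "x \<in> N"
  \<comment> \<open>The enumeration \<open>e\<close> of the volume condition, with the normal in
    last place.\<close>
  define s where "s i = (if i = 1 then Some 1 else if i = 2 then Some 2 else None :: 2 option)" for i :: 3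
  have "range s = UNIV"
    unfolding UNIV_option_conv UNIV_3 UNIV_2 by (simp add: s_def insert_commute)
  moreover have "inj s" unfolding inj_def forall_3 by (simp add: s_def)
  ultimately have "bij s" by (simp add: bij_def)
  then have "\<bar>det (\<chi> i. case s i of None \<Rightarrow> ?n | Some k \<Rightarrow> push ?\<psi> x (e k))\<bar> =
      sqrt \<bar>det (\<chi> i j. affine_metric ?\<psi> (\<lambda>_. ?n) x (e i) (e j))\<bar>"
    using normal x unfolding affine_normal_def by blast
  moreover have "det (\<chi> i. case s i of None \<Rightarrow> ?n | Some k \<Rightarrow> push ?\<psi> x (e k)) = 1"
    by (simp add: det_3 s_def d1[OF x] e_def axis_def)
  moreover have "iter_deriv [e 2, e 1] f x = iter_deriv [e 1, e 2] f x"
    by (rule smooth_on_symmetric[OF smf o x])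
  then have "det (\<chi> i j. affine_metric ?\<psi> (\<lambda>_. ?n) x (e i) (e j)) =
      iter_deriv [e 1, e 1] f x * iter_deriv [e 2, e 2] f x - (iter_deriv [e 1, e 2] f x)\<^sup>2"
    by (simp add: det_2 metric[OF x] power2_eq_square del: iter_deriv.simps)
  ultimately show "\<bar>iter_deriv [e 1, e 1] f x * iter_deriv [e 2, e 2] f x - (iter_deriv [e 1, e 2] f x)\<^sup>2\<bar> = 1"
    by simp
qed

section \<open>The warped hypersurface\<close>

text \<open>The positive definite improper affine sphere enters through the equation
  \<open>hess_det\<close>, with its sign already settled.\<close>

locale warped_affine_normal =
  fixes f :: "real^2 \<Rightarrow> real" and N :: "(real^2) set" and \<gamma> :: "real \<Rightarrow> real^2" and I :: "real set"
    and \<xi> :: "real^3 \<Rightarrow> real^4"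
  assumes open_N: "open N" and smooth_f: "smooth_on N f"
    and hess_det: "x \<in> N \<Longrightarrow> iter_deriv [axis 1 1, axis 1 1] f x * iter_deriv [axis 2 1, axis 2 1] f x
      - (iter_deriv [axis 1 1, axis 2 1] f x)\<^sup>2 = 1"
    and open_I: "open I" and smooth_\<gamma>: "smooth_on I \<gamma>"
    and normal: "affine_normal (product_domain I N) (warped_hypersurface \<gamma> f) \<xi>"
begin

section \<open>Coordinates on the product and derivatives of the immersion up to second
  order\<close>

abbreviation "U \<equiv> product_domain I N"
abbreviation "\<phi> \<equiv> warped_hypersurface \<gamma> f"

text \<open>Being linear, \<open>base\<close> serves both for points and for tangent
  vectors.\<close>

definition base :: "real^3 \<Rightarrow> real^2" where "base x = vector [x$2, x$3]"
definition F :: "(real^2) list \<Rightarrow> real^3 \<Rightarrow> real" where "F vs x = iter_deriv vs f (base x)"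
text \<open>\<open>a n\<close> and \<open>b n\<close> are the \<open>n\<close>-th derivatives of
  \<open>\<gamma>\<^sub>1\<close> and \<open>\<gamma>\<^sub>2\<close>, read as functions on the
  product.\<close>

definition a :: "nat \<Rightarrow> real^3 \<Rightarrow> real" where "a n x = iter_deriv (replicate n 1) \<gamma> (x$1) $ 1"
definition b :: "nat \<Rightarrow> real^3 \<Rightarrow> real" where "b n x = iter_deriv (replicate n 1) \<gamma> (x$1) $ 2"

abbreviation "e1 \<equiv> axis 1 1 :: real^2"
abbreviation "e2 \<equiv> axis 2 1 :: real^2"

lemma domain: "x \<in> U \<longleftrightarrow> x$1 \<in> I \<and> base x \<in> N"
  by (simp add: product_domain_def base_def)

lemma immersed: "immersed_hypersurface U \<phi>"
  using normal by (simp add: affine_normal_def)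

lemma open_U: "open U"
  using immersed by (simp add: immersed_hypersurface_def)

lemma transverse: "x \<in> U \<Longrightarrow> \<xi> x \<notin> range (push \<phi> x)"
  using normal by (simp add: affine_normal_def)

lemma base_linear: "linear base"
  by (rule linearI) (simp_all add: base_def vec_eq_iff forall_2)

lemma base_axis [simp]: "base (axis 1 1) = 0" "base (axis 2 1) = e1" "base (axis 3 1) = e2"
  by (simp_all add: base_def vec_eq_iff forall_2 axis_def)

lemma F_derivative:
  assumes "x \<in> U"
  shows "(F vs has_derivative (\<lambda>h. F (base h # vs) x)) (at x)"
proof -
  have "(iter_deriv vs f has_derivative (\<lambda>h. iter_deriv (h # vs) f (base x))) (at (base x))"
    using assms by (intro smooth_on_has_derivative[OF smooth_f open_N]) (simp add: domain)
  moreover have "(base has_derivative base) (at x)"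
    using base_linear by (simp add: linear_imp_has_derivative)
  ultimately show ?thesis
    unfolding F_def by (rule has_derivative_compose[rotated])
qed

lemma a_derivative: "x \<in> U \<Longrightarrow> (a n has_derivative (\<lambda>h. a (Suc n) x * h$1)) (at x)"
  and b_derivative: "x \<in> U \<Longrightarrow> (b n has_derivative (\<lambda>h. b (Suc n) x * h$1)) (at x)"
proof -
  have "((\<lambda>x. iter_deriv (replicate n 1) \<gamma> (x$1) $ i) has_derivative
      (\<lambda>h. iter_deriv (replicate (Suc n) 1) \<gamma> (x$1) $ i * h$1)) (at x)" if "x \<in> U" for i x
  proof -
    have "((\<lambda>t. iter_deriv (replicate n 1) \<gamma> t $ i) has_derivative
        (*) (iter_deriv (replicate (Suc n) 1) \<gamma> (x$1) $ i)) (at (x$1))"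
      using smooth_on_component_derivative[OF smooth_\<gamma> open_I, of "x$1" "replicate n 1" i] that
      unfolding has_field_derivative_def domain by simp
    moreover have "((\<lambda>x::real^3. x$1) has_derivative (\<lambda>h. h$1)) (at x)"
      by (rule bounded_linear_imp_has_derivative[OF bounded_linear_vec_nth])
    ultimately show ?thesis by (rule has_derivative_compose[rotated])
  qed
  then show "x \<in> U \<Longrightarrow> (a n has_derivative (\<lambda>h. a (Suc n) x * h$1)) (at x)"
    "x \<in> U \<Longrightarrow> (b n has_derivative (\<lambda>h. b (Suc n) x * h$1)) (at x)"
    unfolding a_def b_def by blast+
qed

lemma nth_derivative: "((\<lambda>x::real^3. x$i) has_derivative (\<lambda>h. h$i)) (at x)"
  by (rule bounded_linear_imp_has_derivative[OF bounded_linear_vec_nth])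

lemma F_linear: "x \<in> U \<Longrightarrow> linear (\<lambda>v. F (us @ v # vs) x)"
  unfolding F_def by (rule smooth_on_iter_deriv_linear[OF smooth_f open_N]) (simp add: domain)

lemma F_sym: "x \<in> U \<Longrightarrow> F (u # v # vs) x = F (v # u # vs) x"
  unfolding F_def by (rule smooth_on_symmetric[OF smooth_f open_N]) (simp add: domain)

lemma F_base: "x \<in> U \<Longrightarrow> F (base h # vs) x = h$2 * F (e1 # vs) x + h$3 * F (e2 # vs) x"
proof -
  assume x: "x \<in> U"
  have "base h = h$2 *\<^sub>R e1 + h$3 *\<^sub>R e2" by (simp add: base_def vec_eq_iff forall_2 axis_def)
  then show ?thesis
    using linear_add[OF F_linear[OF x, of "[]"]] linear_scale[OF F_linear[OF x, of "[]"]] by simp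
qed

lemma warped_eq: "\<phi> = (\<lambda>x. vector [a 0 x * x$2, a 0 x * x$3, a 0 x * F [] x + b 0 x, a 0 x])"
  by (simp add: fun_eq_iff warped_hypersurface_def Let_def a_def b_def F_def base_def)

lemma push_eq:
  assumes "x \<in> U"
  shows "push \<phi> x h = vector [a 1 x * h$1 * x$2 + a 0 x * h$2, a 1 x * h$1 * x$3 + a 0 x * h$3,
    a 1 x * h$1 * F [] x + a 0 x * F [base h] x + b 1 x * h$1, a 1 x * h$1]"
proof -
  have "(\<phi> has_derivative (\<lambda>h. vector [a 0 x * h$2 + a 1 x * h$1 * x$2, a 0 x * h$3 + a 1 x * h$1 * x$3,
    (a 0 x * F [base h] x + a 1 x * h$1 * F [] x) + b 1 x * h$1, a 1 x * h$1])) (at x)"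
    unfolding warped_eq One_nat_def
    by (intro has_derivative_vector_4 has_derivative_add has_derivative_mult a_derivative b_derivative
      F_derivative nth_derivative assms)
  then show ?thesis by (simp add: frechet_derivative_at[symmetric] add.commute)
qed

lemma flat_deriv_eq:
  assumes x: "x \<in> U"
  shows "flat_deriv \<phi> (\<lambda>_. u) (\<lambda>_. v) x = vector [
    a 2 x * u$1 * v$1 * x$2 + a 1 x * (v$1 * u$2 + u$1 * v$2),
    a 2 x * u$1 * v$1 * x$3 + a 1 x * (v$1 * u$3 + u$1 * v$3),
    a 2 x * u$1 * v$1 * F [] x + a 1 x * (v$1 * F [base u] x + u$1 * F [base v] x)
      + a 0 x * F [base u, base v] x + b 2 x * u$1 * v$1,
    a 2 x * u$1 * v$1]"
proof -
  have "((\<lambda>x. vector [a 1 x * v$1 * x$2 + a 0 x * v$2, a 1 x * v$1 * x$3 + a 0 x * v$3,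
    a 1 x * v$1 * F [] x + a 0 x * F [base v] x + b 1 x * v$1, a 1 x * v$1] :: real^4) has_derivative
   (\<lambda>u. vector [(a 1 x * v$1 * u$2 + a 2 x * u$1 * v$1 * x$2) + a 1 x * u$1 * v$2,
     (a 1 x * v$1 * u$3 + a 2 x * u$1 * v$1 * x$3) + a 1 x * u$1 * v$3,
     ((a 1 x * v$1 * F [base u] x + a 2 x * u$1 * v$1 * F [] x)
      + (a 0 x * F [base u, base v] x + a 1 x * u$1 * F [base v] x)) + b 2 x * u$1 * v$1,
     a 2 x * u$1 * v$1])) (at x)"
    unfolding One_nat_def numeral_2_eq_2
    by (intro has_derivative_vector_4 has_derivative_add has_derivative_mult has_derivative_mult_left
      a_derivative b_derivative F_derivative nth_derivative assms)
  then have "((\<lambda>q. push \<phi> q v) has_derivative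
   (\<lambda>u. vector [(a 1 x * v$1 * u$2 + a 2 x * u$1 * v$1 * x$2) + a 1 x * u$1 * v$2,
     (a 1 x * v$1 * u$3 + a 2 x * u$1 * v$1 * x$3) + a 1 x * u$1 * v$3,
     ((a 1 x * v$1 * F [base u] x + a 2 x * u$1 * v$1 * F [] x)
      + (a 0 x * F [base u, base v] x + a 1 x * u$1 * F [base v] x)) + b 2 x * u$1 * v$1,
     a 2 x * u$1 * v$1])) (at x)"
    by (rule has_derivative_transform_within_open[OF _ open_U x]) (simp only: push_eq)
  then show ?thesis
    unfolding flat_deriv_def by (simp add: frechet_derivative_at[symmetric] algebra_simps)
qed

section \<open>Affine metric and induced connection by comparison with a constant
  transversal\<close>

abbreviation "e3 \<equiv> axis 3 1 :: real^4"
definition c :: "real^3 \<Rightarrow> real" where "c x = transv_part \<phi> \<xi> x e3"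
definition Z :: "real^3 \<Rightarrow> real^3" where "Z x = tang_part \<phi> \<xi> x e3"
text \<open>The third component of the second \<open>t\<close>-derivative of \<open>\<phi>\<close>
  minus \<open>a 2 x / a 1 x\<close> times the first; the other components of this difference
  vanish.\<close>

definition \<kappa> :: "real^3 \<Rightarrow> real" where "\<kappa> x = b 2 x - b 1 x * a 2 x / a 1 x"
definition Q :: "real^3 \<Rightarrow> real^3 \<Rightarrow> real^3 \<Rightarrow> real" where
  "Q x u v = \<kappa> x * (u$1 * v$1) + a 0 x * F [base u, base v] x"
text \<open>The connection on constant fields that the constant transversal \<open>e3\<close> would
  induce; \<open>Q\<close> is the corresponding second fundamental form.\<close>

definition W :: "real^3 \<Rightarrow> real^3 \<Rightarrow> real^3 \<Rightarrow> real^3" where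
  "W x u v = vector [a 2 x / a 1 x * (u$1 * v$1),
    a 1 x / a 0 x * (v$1 * u$2 + u$1 * v$2), a 1 x / a 0 x * (v$1 * u$3 + u$1 * v$3)]"

lemma e3_decomposition: "x \<in> U \<Longrightarrow> e3 = push \<phi> x (Z x) + c x *\<^sub>R \<xi> x"
  unfolding c_def Z_def by (rule hypersurface_decomposition[where \<xi> = \<xi>, OF immersed _ transverse])

lemma push_linear: "x \<in> U \<Longrightarrow> linear (push \<phi> x)"
  by (rule immersed_hypersurface_push(1)[OF immersed])

text \<open>Otherwise \<open>push \<phi> x\<close> would kill the second coordinate direction,
  against injectivity.\<close>

lemma a0_nonzero: "x \<in> U \<Longrightarrow> a 0 x \<noteq> 0"
proof
  assume x: "x \<in> U" and 0: "a 0 x = 0"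
  have "push \<phi> x (axis 2 1) = push \<phi> x 0"
    unfolding push_eq[OF x] using 0 by (simp add: vec_eq_iff forall_4 axis_nth_eq)
  then have "axis 2 1 = (0 :: real^3)"
    using immersed_hypersurface_push(2)[OF immersed x] by (simp only: inj_eq)
  then show False by simp
qed

text \<open>If \<open>a 1 x\<close> vanished, \<open>e3\<close> would be tangent, being a multiple
  of the pushed first coordinate vector. All second derivatives involving the second coordinate
  direction would then be tangential, against nondegeneracy.\<close>

lemma a1_nonzero:
  assumes x: "x \<in> U"
  shows "a 1 x \<noteq> 0"
proof
  assume 0: "a 1 x = 0"
  have b1: "b 1 x \<noteq> 0"
  proof
    assume "b 1 x = 0"
    with 0 have "push \<phi> x (axis 1 1) = push \<phi> x 0"
      unfolding push_eq[OF x] by (simp add: vec_eq_iff forall_4 axis_nth_eq linear_0[OF base_linear])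
    then have "axis 1 1 = (0 :: real^3)"
      using immersed_hypersurface_push(2)[OF immersed x] by (simp only: inj_eq)
    then show False by simp
  qed
  have "affine_metric \<phi> \<xi> x (axis 2 1) v = 0" for v
    unfolding affine_metric_def
  proof (rule tang_transv_part_eqI(2)[where \<xi> = \<xi>, OF immersed x transverse[OF x]])
    have "F [0] x = 0" using linear_0[OF F_linear[OF x, of "[]" "[]"]] by simp
    then show "flat_deriv \<phi> (\<lambda>_. axis 2 1) (\<lambda>_. v) x =
        push \<phi> x ((a 0 x * F [e1, base v] x / b 1 x) *\<^sub>R axis 1 1) + 0 *\<^sub>R \<xi> x"
      unfolding flat_deriv_eq[OF x] push_eq[OF x] linear_scale[OF base_linear] using 0 b1
      by (simp add: vec_eq_iff forall_4 axis_nth_eq)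
  qed
  then have "axis 2 1 = (0 :: real^3)" using normal x unfolding affine_normal_def nondegenerate_def by blast
  then show False by simp
qed

lemma flat_deriv_decomposition:
  assumes x: "x \<in> U"
  shows "flat_deriv \<phi> (\<lambda>_. u) (\<lambda>_. v) x = push \<phi> x (W x u v + Q x u v *\<^sub>R Z x) + (Q x u v * c x) *\<^sub>R \<xi> x"
proof -
  \<comment> \<open>The decomposition against \<open>e3\<close> comes first; splitting
    \<open>e3\<close> itself then gives the one against \<open>\<xi>\<close>.\<close>
  have "flat_deriv \<phi> (\<lambda>_. u) (\<lambda>_. v) x = push \<phi> x (W x u v) + Q x u v *\<^sub>R e3"
    unfolding flat_deriv_eq[OF x] push_eq[OF x] F_base[OF x]
    using a0_nonzero[OF x] a1_nonzero[OF x]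
    by (simp add: vec_eq_iff forall_4 W_def Q_def \<kappa>_def axis_nth_eq field_simps F_base[OF x])
  then show ?thesis
    by (subst (asm) e3_decomposition[OF x])
      (simp add: linear_add[OF push_linear[OF x]] linear_scale[OF push_linear[OF x]] scaleR_add_right)
qed

lemma metric_eq: "x \<in> U \<Longrightarrow> affine_metric \<phi> \<xi> x u v = Q x u v * c x"
  unfolding affine_metric_def
  by (rule tang_transv_part_eqI(2)[where \<xi> = \<xi>, OF immersed _ transverse flat_deriv_decomposition])

lemma conn_eq: "x \<in> U \<Longrightarrow> induced_conn \<phi> \<xi> (\<lambda>_. u) (\<lambda>_. v) x = W x u v + Q x u v *\<^sub>R Z x"
  unfolding induced_conn_def
  by (rule tang_transv_part_eqI(1)[where \<xi> = \<xi>, OF immersed _ transverse flat_deriv_decomposition])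

lemma metric_nondegenerate: "x \<in> U \<Longrightarrow> nondegenerate (affine_metric \<phi> \<xi> x)"
  using normal by (simp add: affine_normal_def)

lemma F2_linear:
  assumes "x \<in> U"
  shows "F [u + v, w] x = F [u, w] x + F [v, w] x" "F [w, u + v] x = F [w, u] x + F [w, v] x"
    "F [k *\<^sub>R u, w] x = k * F [u, w] x" "F [w, k *\<^sub>R u] x = k * F [w, u] x"
  using linear_add[OF F_linear[OF assms, of "[]" "[w]"]] linear_add[OF F_linear[OF assms, of "[w]" "[]"]]
    linear_scale[OF F_linear[OF assms, of "[]" "[w]"]] linear_scale[OF F_linear[OF assms, of "[w]" "[]"]]
  by simp_all

lemma Q_bilinear: "x \<in> U \<Longrightarrow> bilinear (Q x)"
  unfolding bilinear_def
  by (intro conjI allI linearI)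
    (simp_all add: Q_def F2_linear linear_add[OF base_linear] linear_scale[OF base_linear] algebra_simps)

lemma Q_sym: "x \<in> U \<Longrightarrow> Q x u v = Q x v u"
  by (simp add: Q_def F_sym[of _ "base u"] mult.commute)

section \<open>Conormal, volume condition and the direction of the field \<open>Z\<close>\<close>

lemma hess_det': "x \<in> U \<Longrightarrow> F [e1, e1] x * F [e2, e2] x - (F [e1, e2] x)\<^sup>2 = 1"
  using hess_det unfolding F_def domain by blast

text \<open>The conormal covector, normalized to take the value \<open>1\<close> on \<open>e3\<close>.\<close>

definition \<mu> :: "real^3 \<Rightarrow> real" where
  "\<mu> x = - (F [] x - (x$2 * F [e1] x + x$3 * F [e2] x) + b 1 x / a 1 x)"
definition conormal :: "real^3 \<Rightarrow> real^4 \<Rightarrow> real" where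
  "conormal x u = u$3 - (F [e1] x * u$1 + F [e2] x * u$2) + \<mu> x * u$4"

text \<open>The first three coefficients annihilate the pushed second and third coordinate vectors;
  \<open>\<mu>\<close> is the solution of the remaining equation for the first one.\<close>

lemma conormal_push: "x \<in> U \<Longrightarrow> conormal x (push \<phi> x h) = 0"
  using a1_nonzero[of x]
  by (simp add: conormal_def push_eq F_base \<mu>_def field_simps)

text \<open>The conormal is applied to the decomposition of \<open>e3\<close>. In particular neither
  factor vanishes.\<close>

lemma conormal_\<xi>:
  assumes x: "x \<in> U"
  shows "c x * conormal x (\<xi> x) = 1"
proof -
  have "conormal x e3 = 1" by (simp add: conormal_def axis_nth_eq)
  moreover have "conormal x (push \<phi> x (Z x) + c x *\<^sub>R \<xi> x) = conormal x (push \<phi> x (Z x)) + c x * conormal x (\<xi> x)"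
    by (simp add: conormal_def algebra_simps)
  ultimately show ?thesis using e3_decomposition[OF x] conormal_push[OF x] by simp
qed

text \<open>The frame determinant is, up to sign, \<open>(a 0 x)\<^sup>2 * a 1 x * u\<close> with
  \<open>u\<close> the conormal value of \<open>\<xi>\<close>, and the Gram determinant is
  \<open>c x ^ 3 * \<kappa> x * (a 0 x)\<^sup>2\<close>. Squaring twice removes the root and the
  absolute value. Apart from \<open>u\<close>, only functions of \<open>t\<close> remain.\<close>

lemma volume:
  assumes x: "x \<in> U"
  shows "(a 0 x)^4 * (a 1 x)^4 * (conormal x (\<xi> x))^10 = (\<kappa> x)\<^sup>2"
proof -
  define s where "s i = (if i = 1 then Some 1 else if i = 2 then Some 2 else if i = 3 then Some 3 else None :: 3 option)" for i :: 4
  define u where "u = conormal x (\<xi> x)"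
  define D where "D = c x ^ 3 * (\<kappa> x * (a 0 x)\<^sup>2)"
  have u: "c x * u = 1" using conormal_\<xi>[OF x] by (simp add: u_def)
  have "range s = UNIV"
    unfolding UNIV_option_conv UNIV_4 UNIV_3 by (simp add: s_def insert_commute)
  moreover have "inj s" unfolding inj_def forall_4 by (simp add: s_def)
  ultimately have "bij s" by (simp add: bij_def)
  then have "\<bar>det (\<chi> i. case s i of None \<Rightarrow> \<xi> x | Some k \<Rightarrow> push \<phi> x (axis k 1))\<bar> =
      sqrt \<bar>det (\<chi> i j. affine_metric \<phi> \<xi> x (axis i 1) (axis j 1))\<bar>"
    using normal[unfolded affine_normal_def, THEN conjunct2, THEN conjunct2, THEN bspec, OF x,
        THEN conjunct2, THEN conjunct2, THEN conjunct2, THEN spec, THEN spec, of s "\<lambda>k. axis k 1"]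
    by simp
  moreover have "det (\<chi> i. case s i of None \<Rightarrow> \<xi> x | Some k \<Rightarrow> push \<phi> x (axis k 1)) = - ((a 0 x)\<^sup>2 * a 1 x * u)"
  proof -
    have "F [0] x = 0" using linear_0[OF F_linear[OF x, of "[]" "[]"]] by simp
    then show ?thesis
      using a1_nonzero[OF x]
      by (simp add: det_4 s_def push_eq[OF x] u_def conormal_def \<mu>_def axis_nth_eq field_simps power2_eq_square)
  qed
  moreover have "det (\<chi> i j. affine_metric \<phi> \<xi> x (axis i 1) (axis j 1)) = D"
  proof -
    have "F [0, v] x = 0" "F [v, 0] x = 0" for v
      using linear_0[OF F_linear[OF x, of "[]" "[v]"]] linear_0[OF F_linear[OF x, of "[v]" "[]"]] by simp_all
    then have "det (\<chi> i j. affine_metric \<phi> \<xi> x (axis i 1) (axis j 1)) =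
      c x ^ 3 * (\<kappa> x * (a 0 x)\<^sup>2) * (F [e1, e1] x * F [e2, e2] x - (F [e1, e2] x)\<^sup>2)"
      by (simp add: det_3 metric_eq[OF x] Q_def F_sym[OF x, of e2 e1] axis_nth_eq power2_eq_square power3_eq_cube algebra_simps)
    then show ?thesis using hess_det'[OF x] by (simp add: D_def)
  qed
  ultimately have "\<bar>(a 0 x)\<^sup>2 * a 1 x * u\<bar> = sqrt \<bar>D\<bar>" by simp
  then have "((a 0 x)\<^sup>2 * a 1 x * u)\<^sup>2 = \<bar>D\<bar>" by (metis abs_ge_zero power2_abs real_sqrt_pow2)
  \<comment> \<open>The factor \<open>u^6\<close> cancels the sixth power of \<open>c x\<close>
    contained in \<open>D\<^sup>2\<close>.\<close>
  then have "(((a 0 x)\<^sup>2 * a 1 x * u)\<^sup>2)\<^sup>2 * u^6 = D\<^sup>2 * u^6" by simp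
  also have "D\<^sup>2 * u^6 = (c x * u)^6 * ((\<kappa> x)\<^sup>2 * (a 0 x)^4)" by (simp add: D_def power_mult_distrib algebra_simps flip: power_mult)
  also have "\<dots> = (a 0 x)^4 * (\<kappa> x)\<^sup>2" using u by simp
  finally have "(a 0 x)^4 * ((a 0 x)^4 * (a 1 x)^4 * u^10) = (a 0 x)^4 * (\<kappa> x)\<^sup>2"
    by (simp add: power_mult_distrib algebra_simps flip: power_mult power_add)
  then show ?thesis using a0_nonzero[OF x] by (simp add: u_def)
qed

text \<open>Up to a function of \<open>t\<close>, \<open>\<mu>\<close> is the Legendre transform
  expression of \<open>f\<close>, so the first derivatives of \<open>f\<close> cancel.\<close>

lemma \<mu>_derivative:
  assumes x: "x \<in> U"
  obtains m where "(\<mu> has_derivative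
     (\<lambda>h. x$2 * F [base h, e1] x + x$3 * F [base h, e2] x + m * h$1)) (at x)"
proof -
  define m where "m = - (b 2 x * a 1 x - b 1 x * a 2 x) / (a 1 x * a 1 x)"
  have "(\<mu> has_derivative (\<lambda>h. - (F [base h] x
      - ((x$2 * F [base h, e1] x + h$2 * F [e1] x) + (x$3 * F [base h, e2] x + h$3 * F [e2] x))
      + (b (Suc 1) x * h$1 * a 1 x - b 1 x * (a (Suc 1) x * h$1)) / (a 1 x * a 1 x)))) (at x)"
    unfolding \<mu>_def[abs_def]
    by (intro has_derivative_minus has_derivative_add has_derivative_diff has_derivative_mult
       has_derivative_divide' a_derivative b_derivative F_derivative nth_derivative a1_nonzero x)
  moreover have "(\<lambda>h. - (F [base h] x
      - ((x$2 * F [base h, e1] x + h$2 * F [e1] x) + (x$3 * F [base h, e2] x + h$3 * F [e2] x))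
      + (b (Suc 1) x * h$1 * a 1 x - b 1 x * (a (Suc 1) x * h$1)) / (a 1 x * a 1 x)))
    = (\<lambda>h. x$2 * F [base h, e1] x + x$3 * F [base h, e2] x + m * h$1)"
    unfolding m_def numeral_2_eq_2 One_nat_def F_base[OF x, of _ "[]"]
    using a1_nonzero[OF x] by (auto simp: field_simps)
  ultimately show ?thesis using that by simp
qed

text \<open>The conormal annihilates \<open>D\<xi>\<close>, which is tangential, so only its own derivative contributes.\<close>

lemma conormal_\<xi>_derivative:
  assumes x: "x \<in> U"
  obtains m where "((\<lambda>x. conormal x (\<xi> x)) has_derivative
     (\<lambda>h. m * h$1 - (F [base h, e1] x * (\<xi> x $ 1 - x$2 * \<xi> x $ 4)
        + F [base h, e2] x * (\<xi> x $ 2 - x$3 * \<xi> x $ 4)))) (at x)"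
proof -
  obtain m where m: "(\<mu> has_derivative
     (\<lambda>h. x$2 * F [base h, e1] x + x$3 * F [base h, e2] x + m * h$1)) (at x)"
    by (rule \<mu>_derivative[OF x])
  have smooth: "smooth_on U \<xi>" and tangential: "frechet_derivative \<xi> (at x) h \<in> range (push \<phi> x)" for h
    using normal x by (auto simp: affine_normal_def)
  have \<xi>: "(\<xi> has_derivative frechet_derivative \<xi> (at x)) (at x)"
    using smooth_on_has_derivative[OF smooth open_U x, of "[]"] by simp
  let ?d = "\<lambda>i h. frechet_derivative \<xi> (at x) h $ i"
  have \<xi>i: "((\<lambda>x. \<xi> x $ i) has_derivative ?d i) (at x)" for i
    by (rule bounded_linear.has_derivative[OF bounded_linear_vec_nth \<xi>])
  have "((\<lambda>x. conormal x (\<xi> x)) has_derivative (\<lambda>h. ?d 3 h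
      - ((F [e1] x * ?d 1 h + F [base h, e1] x * \<xi> x $ 1) + (F [e2] x * ?d 2 h + F [base h, e2] x * \<xi> x $ 2))
      + (\<mu> x * ?d 4 h + (x$2 * F [base h, e1] x + x$3 * F [base h, e2] x + m * h$1) * \<xi> x $ 4))) (at x)"
    unfolding conormal_def
    by (intro has_derivative_add has_derivative_diff has_derivative_mult m \<xi>i F_derivative x)
  moreover have "?d 3 h
      - ((F [e1] x * ?d 1 h + F [base h, e1] x * \<xi> x $ 1) + (F [e2] x * ?d 2 h + F [base h, e2] x * \<xi> x $ 2))
      + (\<mu> x * ?d 4 h + (x$2 * F [base h, e1] x + x$3 * F [base h, e2] x + m * h$1) * \<xi> x $ 4)
    = (m * \<xi> x $ 4) * h$1 - (F [base h, e1] x * (\<xi> x $ 1 - x$2 * \<xi> x $ 4)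
        + F [base h, e2] x * (\<xi> x $ 2 - x$3 * \<xi> x $ 4))" for h
  proof -
    have "conormal x (frechet_derivative \<xi> (at x) h) = 0"
      using tangential[of h] conormal_push[OF x] by auto
    then show ?thesis unfolding conormal_def by (simp add: algebra_simps)
  qed
  ultimately show ?thesis using that by simp
qed

text \<open>Along a line with constant \<open>t\<close> the identity \<open>volume\<close> fixes the
  tenth power of the conormal value. Differentiating that power and dividing by the nonzero ninth
  power avoids any discussion of signs.\<close>

lemma conormal_\<xi>_vertical_derivative:
  assumes x: "x \<in> U" and h: "h$1 = 0" and D: "((\<lambda>x. conormal x (\<xi> x)) has_derivative D) (at x)"
  shows "D h = 0"
proof -
  define u where "u s = conormal (x + s *\<^sub>R h) (\<xi> (x + s *\<^sub>R h))" for s :: real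
  have "((\<lambda>s. x + s *\<^sub>R h) has_derivative (\<lambda>s. s *\<^sub>R h)) (at 0)"
    by (auto intro!: derivative_eq_intros)
  then have "(u has_derivative (\<lambda>s. D (s *\<^sub>R h))) (at 0)"
    unfolding u_def by (rule has_derivative_compose) (use D in simp)
  then have "(u has_real_derivative D h) (at 0)"
    using linear_scale[OF has_derivative_linear[OF D]] by (simp add: has_field_derivative_def mult_commute_abs)
  then have d1: "((\<lambda>s. u s ^ 10) has_real_derivative (10 * u 0 ^ 9 * D h)) (at 0)"
    by (auto intro!: derivative_eq_intros)
  \<comment> \<open>The parameters for which the line stays in \<open>U\<close>, an open
    neighbourhood of 0.\<close>
  define V where "V = (\<lambda>s. x + s *\<^sub>R h) -` U"
  have V: "open V" "0 \<in> V"
    using x unfolding V_def by (auto intro!: open_vimage open_U continuous_intros)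
  have "u s ^ 10 = u 0 ^ 10" if "s \<in> V" for s
  proof -
    have y: "x + s *\<^sub>R h \<in> U" using that by (simp add: V_def)
    have "a n (x + s *\<^sub>R h) = a n x" "b n (x + s *\<^sub>R h) = b n x" for n using h by (simp_all add: a_def b_def)
    then have "(a 0 x)^4 * (a 1 x)^4 * u s ^ 10 = (\<kappa> x)\<^sup>2"
      using volume[OF y] by (simp add: u_def \<kappa>_def)
    moreover have "(a 0 x)^4 * (a 1 x)^4 * u 0 ^ 10 = (\<kappa> x)\<^sup>2"
      using volume[OF x] by (simp add: u_def)
    ultimately show ?thesis using a0_nonzero[OF x] a1_nonzero[OF x]
      by (metis mult_cancel_left no_zero_divisors power_not_zero)
  qed
  then have "((\<lambda>s. u s ^ 10) has_real_derivative 0) (at 0)"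
    using DERIV_const has_field_derivative_transform_within_open[OF DERIV_const[of "u 0 ^ 10"] V] by metis
  with d1 have "10 * u 0 ^ 9 * D h = 0" by (rule DERIV_unique)
  moreover have "u 0 \<noteq> 0" using conormal_\<xi>[OF x] by (auto simp: u_def)
  ultimately show ?thesis by simp
qed

text \<open>Vanishing vertical derivatives say that the Hessian of \<open>f\<close> annihilates the
  pair \<open>(p, q)\<close>, which is therefore zero. Components 1, 2 and 4 of the decomposition of
  \<open>e3\<close> express \<open>a 0 x * Z x $ 2\<close> and \<open>a 0 x * Z x $ 3\<close> as
  \<open>- c x * p\<close> and \<open>- c x * q\<close>.\<close>

lemma Z_vertical:
  assumes x: "x \<in> U"
  shows "Z x $ 2 = 0" "Z x $ 3 = 0"
proof -
  define p q where "p = \<xi> x $ 1 - x$2 * \<xi> x $ 4" and "q = \<xi> x $ 2 - x$3 * \<xi> x $ 4"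
  obtain m where D: "((\<lambda>x. conormal x (\<xi> x)) has_derivative
     (\<lambda>h. m * h$1 - (F [base h, e1] x * p + F [base h, e2] x * q))) (at x)"
    using conormal_\<xi>_derivative[OF x] unfolding p_def q_def by blast
  have "F [e1, e1] x * p + F [e1, e2] x * q = 0" "F [e2, e1] x * p + F [e2, e2] x * q = 0"
    using conormal_\<xi>_vertical_derivative[OF x _ D, of "axis 2 1"]
      conormal_\<xi>_vertical_derivative[OF x _ D, of "axis 3 1"] by (simp_all add: axis_nth_eq)
  then have "p = 0 \<and> q = 0"
    using hess_det'[OF x] F_sym[OF x, of e2 e1 "[]"] by algebra
  moreover have "e3 $ i = push \<phi> x (Z x) $ i + c x * \<xi> x $ i" for i
    using arg_cong[OF e3_decomposition[OF x], of "\<lambda>v. v $ i"] by simp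
  from this[of 1] this[of 2] this[of 4]
  have "0 = a 1 x * Z x $ 1 * x$2 + a 0 x * Z x $ 2 + c x * \<xi> x $ 1"
    "0 = a 1 x * Z x $ 1 * x$3 + a 0 x * Z x $ 3 + c x * \<xi> x $ 2"
    "0 = a 1 x * Z x $ 1 + c x * \<xi> x $ 4"
    by (simp_all add: push_eq[OF x] axis_nth_eq)
  ultimately have "a 0 x * Z x $ 2 = 0" "a 0 x * Z x $ 3 = 0"
    unfolding p_def q_def by algebra+
  then show "Z x $ 2 = 0" "Z x $ 3 = 0" using a0_nonzero[OF x] by simp_all
qed

section \<open>Derivative of the affine metric and third derivatives of the base function\<close>

lemma c_derivative:
  assumes x: "x \<in> U"
  obtains m where "(c has_derivative (\<lambda>h. m * h$1)) (at x)"
proof -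
  obtain D where D: "((\<lambda>x. conormal x (\<xi> x)) has_derivative D) (at x)"
    using conormal_\<xi>_derivative[OF x] by blast
  have Dh: "D h = D (axis 1 1) * h$1" for h
  proof -
    \<comment> \<open>Removing the first coordinate part leaves a vertical vector, on which
      \<open>D\<close> vanishes.\<close>
    have "D (h - h$1 *\<^sub>R axis 1 1) = 0"
      by (rule conormal_\<xi>_vertical_derivative[OF x _ D]) (simp add: axis_nth_eq)
    then show ?thesis
      using linear_diff[OF has_derivative_linear[OF D]] linear_scale[OF has_derivative_linear[OF D]] by simp
  qed
  have u: "conormal x (\<xi> x) \<noteq> 0" using conormal_\<xi>[OF x] by auto
  let ?i = "inverse (conormal x (\<xi> x))"
  have "((\<lambda>x. inverse (conormal x (\<xi> x))) has_derivative (\<lambda>h. - (?i * D h * ?i))) (at x)"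
    by (rule Deriv.has_derivative_inverse[OF u D])
  \<comment> \<open>\<open>c\<close> is a definite description at each point;
    \<open>conormal_\<xi>\<close> identifies it on \<open>U\<close> with the reciprocal just
    differentiated.\<close>
  then have "(c has_derivative (\<lambda>h. - (?i * D h * ?i))) (at x)"
    by (rule has_derivative_transform_within_open[OF _ open_U x]) (use conormal_\<xi> in \<open>simp add: inverse_unique mult.commute\<close>)
  moreover have "(\<lambda>h. - (?i * D h * ?i)) = (\<lambda>h. - (?i * D (axis 1 1) * ?i) * h$1)"
    by (subst Dh) (simp add: algebra_simps)
  ultimately show ?thesis using that by metis
qed

text \<open>Since \<open>\<kappa>\<close>, \<open>a 0\<close> and \<open>c\<close> have derivatives
  proportional to \<open>h$1\<close>, differentiation in other directions only reaches the Hessian.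
  That \<open>A\<close> and \<open>B\<close> do not depend on \<open>u\<close> and \<open>v\<close>
  is what makes the invariance under rotations visible.\<close>

lemma metric_derivative:
  assumes x: "x \<in> U"
  obtains A B where "\<And>u v. ((\<lambda>x. affine_metric \<phi> \<xi> x u v) has_derivative
    (\<lambda>h. h$1 * (A * (u$1 * v$1) + B * F [base u, base v] x) + a 0 x * c x * F [base h, base u, base v] x)) (at x)"
proof -
  obtain m where m: "(c has_derivative (\<lambda>h. m * h$1)) (at x)" by (rule c_derivative[OF x])
  \<comment> \<open>The \<open>t\<close>-derivative of \<open>\<kappa>\<close> by the quotient
    rule.\<close>
  define k where "k = b 3 x - ((b 1 x * a 3 x + b 2 x * a 2 x) * a 1 x - b 1 x * a 2 x * a 2 x) / (a 1 x * a 1 x)"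
  have "(\<kappa> has_derivative (\<lambda>h. b (Suc 2) x * h$1 - ((b 1 x * (a (Suc 2) x * h$1) + b (Suc 1) x * h$1 * a 2 x) * a 1 x
      - b 1 x * a 2 x * (a (Suc 1) x * h$1)) / (a 1 x * a 1 x))) (at x)"
    unfolding \<kappa>_def[abs_def]
    by (intro has_derivative_diff has_derivative_mult has_derivative_divide' a_derivative b_derivative a1_nonzero x)
  moreover have "b (Suc 2) x * h$1 - ((b 1 x * (a (Suc 2) x * h$1) + b (Suc 1) x * h$1 * a 2 x) * a 1 x
      - b 1 x * a 2 x * (a (Suc 1) x * h$1)) / (a 1 x * a 1 x) = k * h$1" for h :: "real^3"
    using a1_nonzero[OF x] by (simp add: k_def field_simps numeral_2_eq_2 numeral_3_eq_3)
  ultimately have k: "(\<kappa> has_derivative (\<lambda>h. k * h$1)) (at x)" by simp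
  have "((\<lambda>x. affine_metric \<phi> \<xi> x u v) has_derivative
    (\<lambda>h. h$1 * ((\<kappa> x * m + k * c x) * (u$1 * v$1) + (a 0 x * m + a 1 x * c x) * F [base u, base v] x)
      + a 0 x * c x * F [base h, base u, base v] x)) (at x)" for u v
  proof -
    have "((\<lambda>x. Q x u v * c x) has_derivative (\<lambda>h. Q x u v * (m * h$1) +
      (k * h$1 * (u$1 * v$1) + (a 0 x * F [base h, base u, base v] x + a (Suc 0) x * h$1 * F [base u, base v] x)) * c x)) (at x)"
      unfolding Q_def
      by (intro has_derivative_add has_derivative_mult has_derivative_mult_left k m a_derivative F_derivative x)
    then have "((\<lambda>x. affine_metric \<phi> \<xi> x u v) has_derivative (\<lambda>h. Q x u v * (m * h$1) +
      (k * h$1 * (u$1 * v$1) + (a 0 x * F [base h, base u, base v] x + a (Suc 0) x * h$1 * F [base u, base v] x)) * c x)) (at x)"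
      by (rule has_derivative_transform_within_open[OF _ open_U x]) (simp add: metric_eq)
    then show ?thesis by (simp add: Q_def algebra_simps)
  qed
  then show ?thesis by (rule that)
qed

lemma base_surj: obtains h where "base h = v"
  by (rule that[of "vector [0, v$1, v$2]"]) (simp add: base_def vec_eq_iff forall_2)

text \<open>Differentiates \<open>F_sym\<close>, which holds on all of \<open>U\<close>.\<close>

lemma F3_sym:
  assumes x: "x \<in> U"
  shows "F [u, v, w] x = F [u, w, v] x"
proof -
  obtain h where h: "base h = u" by (rule base_surj)
  have "(F [w, v] has_derivative (\<lambda>h. F [base h, v, w] x)) (at x)"
    by (rule has_derivative_transform_within_open[OF F_derivative[OF x] open_U x]) (rule F_sym)
  from has_derivative_unique[OF this F_derivative[OF x]] show ?thesis using h by metis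
qed

text \<open>The derivative of the equation \<open>hess_det'\<close> in direction \<open>z\<close>;
  it supplies the trace condition of \<open>traceless_cubic_rotation\<close>.\<close>

lemma F3_traceless:
  assumes x: "x \<in> U"
  shows "F [z, e1, e1] x * F [e2, e2] x + F [e1, e1] x * F [z, e2, e2] x = 2 * F [e1, e2] x * F [z, e1, e2] x"
proof -
  obtain h where h: "base h = z" by (rule base_surj)
  let ?D = "\<lambda>h. (F [e1, e1] x * F [base h, e2, e2] x + F [base h, e1, e1] x * F [e2, e2] x)
      - (F [e1, e2] x * F [base h, e1, e2] x + F [base h, e1, e2] x * F [e1, e2] x)"
  have "((\<lambda>x. F [e1, e1] x * F [e2, e2] x - F [e1, e2] x * F [e1, e2] x) has_derivative ?D) (at x)"
    by (intro has_derivative_diff has_derivative_mult F_derivative x)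
  then have "((\<lambda>x. 1) has_derivative ?D) (at x)"
    by (rule has_derivative_transform_within_open[OF _ open_U x])
      (use hess_det' in \<open>simp add: power2_eq_square\<close>)
  from has_derivative_unique[OF this has_derivative_const] have "?D h = 0" by metis
  then show ?thesis unfolding h by (simp add: algebra_simps)
qed

text \<open>A rotation preserving the Hessian and the third derivative of \<open>f\<close>, extended
  by the identity in the first coordinate, preserves the metric and every term of the cubic form
  \<open>h(K(u, v), w)\<close>.\<close>

lemma Z3_symmetry:
  assumes x: "x \<in> U"
  shows "symmetry_at \<phi> \<xi> x Z3"
proof -
  \<comment> \<open>The Hessian of \<open>f\<close> at the base point is the metric of the plane and
    the third derivative is the cubic form.\<close>
  obtain R where R: "linear R" "R \<noteq> id" "\<And>v. R (R (R v)) = v"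
    "\<And>u v. F [R u, R v] x = F [u, v] x" "\<And>u v w. F [R u, R v, R w] x = F [u, v, w] x"
    "R e1 $ 1 * R e2 $ 2 - R e1 $ 2 * R e2 $ 1 = 1"
  proof (rule traceless_cubic_rotation[of "\<lambda>u v. F [u, v] x" "\<lambda>w u v. F [w, u, v] x"])
    show "bilinear (\<lambda>u v. F [u, v] x)"
      using F_linear[OF x, of "[]"] F_linear[OF x, of "[u]" "[]" for u] by (simp add: bilinear_def)
    show "bilinear (\<lambda>u v. F [w, u, v] x)" for w
      using F_linear[OF x, of "[w]"] F_linear[OF x, of "[w, u]" "[]" for u] by (simp add: bilinear_def)
  qed (rule F_sym[OF x] F3_sym[OF x] F3_traceless[OF x] hess_det'[OF x] | blast)+
  define L :: "real^3 \<Rightarrow> real^3" where "L u = vector [u$1, R (base u) $ 1, R (base u) $ 2]" for u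
  have L1: "L u $ 1 = u $ 1" and L_base: "base (L u) = R (base u)" for u
    by (simp_all add: L_def base_def vec_eq_iff forall_2)
  have eqI: "u = v" if "u$1 = v$1" "base u = base v" for u v :: "real^3"
    using that by (simp add: vec_eq_iff forall_3 base_def forall_2)
  have L_linear: "linear L"
    by (rule linearI; rule eqI)
      (simp_all add: L1 L_base linear_add[OF base_linear] linear_scale[OF base_linear] linear_add[OF R(1)] linear_scale[OF R(1)])
  have L3: "L (L (L u)) = u" for u by (rule eqI) (simp_all add: L1 L_base R(3))
  have Q_L: "Q x (L u) (L v) = Q x u v" for u v by (simp add: Q_def L1 L_base R(4))
  have "det (matrix L) = 1"
    using R(6) linear_0[OF R(1)] by (simp add: det_3 matrix_def L_def axis_nth_eq mult.commute)
  then have L_iso: "L \<in> carrier (special_isometry_group (affine_metric \<phi> \<xi> x))"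
    by (simp add: special_isometry_group_def L_linear metric_eq[OF x] Q_L)
  have "L \<noteq> id"
  proof
    assume L: "L = id"
    have "R v = v" for v
    proof -
      obtain u where "base u = v" by (rule base_surj)
      then show ?thesis using L_base[of u] L by simp
    qed
    then show False using R(2) by auto
  qed
  obtain A B where dg: "\<And>u v. ((\<lambda>x. affine_metric \<phi> \<xi> x u v) has_derivative
    (\<lambda>h. h$1 * (A * (u$1 * v$1) + B * F [base u, base v] x) + a 0 x * c x * F [base h, base u, base v] x)) (at x)"
    using metric_derivative[OF x] by blast
  let ?g = "affine_metric \<phi> \<xi> x" and ?K = "difference_tensor \<phi> \<xi> x"
  let ?dg = "\<lambda>u v h. h$1 * (A * (u$1 * v$1) + B * F [base u, base v] x) + a 0 x * c x * F [base h, base u, base v] x"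
  have bil: "bilinear (affine_metric \<phi> \<xi> y)" if "y \<in> U" for y
    unfolding bilinear_def
    by (intro conjI allI linearI)
      (simp_all add: metric_eq that bilinear_ladd[OF Q_bilinear] bilinear_radd[OF Q_bilinear]
        bilinear_lmul[OF Q_bilinear] bilinear_rmul[OF Q_bilinear] algebra_simps)
  have sym: "affine_metric \<phi> \<xi> y u v = affine_metric \<phi> \<xi> y v u" if "y \<in> U" for y u v
    by (simp add: metric_eq that Q_sym[of y u v])
  have koszul: "2 * ?g (levi_civita_symbol (affine_metric \<phi> \<xi>) x u v) w = ?dg v w u + ?dg u w v - ?dg u v w" for u v w
    by (rule levi_civita_symbol_koszul[OF open_U x bil sym metric_nondegenerate[OF x] dg])
  have base_Z: "base (Z x) = 0" by (simp add: base_def Z_vertical[OF x] vec_eq_iff forall_2)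
  have base_W: "base (W x u v) = (a 1 x / a 0 x) *\<^sub>R (v$1 *\<^sub>R base u + u$1 *\<^sub>R base v)" for u v
    by (simp add: base_def W_def vec_eq_iff forall_2)
  \<comment> \<open>The right-hand side sees \<open>u\<close>, \<open>v\<close>, \<open>w\<close>
    only through first coordinates, \<open>Q\<close>, and second and third derivatives of
    \<open>f\<close> along base parts; \<open>base_Z\<close> keeps any other component of
    \<open>Z\<close> from entering.\<close>
  have K: "2 * ?g (?K u v) w = 2 * c x * (\<kappa> x * ((a 2 x / a 1 x * (u$1 * v$1) + Q x u v * Z x $ 1) * w$1)
       + a 1 x * (v$1 * F [base u, base w] x + u$1 * F [base v, base w] x))
     - (?dg v w u + ?dg u w v - ?dg u v w)" for u v w
  proof -
    have "?g (?K u v) w = ?g (W x u v + Q x u v *\<^sub>R Z x) w - ?g (levi_civita_symbol (affine_metric \<phi> \<xi>) x u v) w"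
      by (simp add: difference_tensor_def conn_eq[OF x] levi_civita_def cov_deriv_def bilinear_lsub[OF bil[OF x]])
    moreover have "?g (W x u v + Q x u v *\<^sub>R Z x) w = c x * (\<kappa> x * ((a 2 x / a 1 x * (u$1 * v$1) + Q x u v * Z x $ 1) * w$1)
       + a 1 x * (v$1 * F [base u, base w] x + u$1 * F [base v, base w] x))"
      unfolding metric_eq[OF x] Q_def[of x "W x u v + Q x u v *\<^sub>R Z x" w]
        linear_add[OF base_linear] linear_scale[OF base_linear] base_Z base_W
      using a0_nonzero[OF x] by (simp add: F2_linear[OF x]) (simp add: W_def)
    ultimately show ?thesis by (simp only: right_diff_distrib koszul mult.assoc)
  qed
  have K_L: "?g (?K (L u) (L v)) (L w) = ?g (?K u v) w" for u v w
  proof -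
    have "2 * ?g (?K (L u) (L v)) (L w) = 2 * ?g (?K u v) w"
      unfolding K L1 L_base R(4,5) Q_L ..
    then show ?thesis by simp
  qed
  have "?K (L u) (L v) = L (?K u v)" for u v
  proof (rule nondegenerate_eqI[OF bil[OF x] metric_nondegenerate[OF x]])
    fix z
    \<comment> \<open>Writing \<open>z\<close> as \<open>L (L (L z))\<close> gives the second
      argument the outer \<open>L\<close> that \<open>K_L\<close> and \<open>Q_L\<close>
      require.\<close>
    have "?g (?K (L u) (L v)) (L (L (L z))) = ?g (L (?K u v)) (L (L (L z)))"
      unfolding K_L unfolding metric_eq[OF x] Q_L ..
    then show "?g (?K (L u) (L v)) z = ?g (L (?K u v)) z" by (simp only: L3)
  qed
  then show ?thesis
    using L_iso \<open>L \<noteq> id\<close> L3 by (intro symmetry_at_Z3I[of L]) (auto simp: fun_eq_iff)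
qed

end

theorem theorem6:
  fixes f :: "real^2 \<Rightarrow> real" and N :: "(real^2) set"
    and \<gamma> :: "real \<Rightarrow> real^2" and I :: "real set"
    and \<xi> :: "real^3 \<Rightarrow> real^4" and H :: real
  assumes base: "affine_hypersphere N (graph_surface f) (\<lambda>_. vector [0, 0, 1]) 0"
    and base_pos: "\<forall>x\<in>N. positive_definite (affine_metric (graph_surface f) (\<lambda>_. vector [0, 0, 1]) x)"
    and curve: "open I" "is_interval I" "smooth_on I \<gamma>"
    and sphere: "affine_hypersphere (product_domain I N) (warped_hypersurface \<gamma> f) \<xi> H"
    and proper: "H \<noteq> 0"
    and indef: "\<forall>p\<in>product_domain I N. indefinite (affine_metric (warped_hypersurface \<gamma> f) \<xi> p)"
    and normalization:
      "\<forall>p\<in>product_domain I N. negative_index (affine_metric (warped_hypersurface \<gamma> f) \<xi> p) = 1"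
  shows "\<forall>p\<in>product_domain I N.
    symmetry_at (warped_hypersurface \<gamma> f) \<xi> p Z3 \<or> symmetry_at (warped_hypersurface \<gamma> f) \<xi> p SO2"
proof -
  have normal: "affine_normal N (graph_surface f) (\<lambda>_. vector [0, 0, 1])"
    using base by (simp add: affine_hypersphere_def)
  note graph = improper_graph_surface[OF normal]
  have det: "iter_deriv [axis 1 1, axis 1 1] f x * iter_deriv [axis 2 1, axis 2 1] f x
      - (iter_deriv [axis 1 1, axis 2 1] f x)\<^sup>2 = 1" if x: "x \<in> N" for x
  proof -
    define h where "h u v = iter_deriv [u, v] f x" for u v :: "real^2"
    let ?e1 = "axis 1 1 :: real^2" and ?e2 = "axis 2 1 :: real^2"
    define p q r where "p = h ?e1 ?e1" and "q = h ?e1 ?e2" and "r = h ?e2 ?e2"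
    have bil: "bilinear h"
      using smooth_on_iter_deriv_linear[OF graph(2,1) x, of "[]" "[v]" for v]
        smooth_on_iter_deriv_linear[OF graph(2,1) x, of "[u]" "[]" for u]
      unfolding bilinear_def h_def by simp
    have sym: "h ?e2 ?e1 = q" unfolding q_def h_def by (rule smooth_on_symmetric[OF graph(2,1) x])
    have pos: "h v v > 0" if "v \<noteq> 0" for v
      using base_pos x that graph(3)[OF x, of v v] unfolding positive_definite_def h_def by metis
    have "p > 0" unfolding p_def by (rule pos) simp
    \<comment> \<open>This vector is \<open>h\<close>-orthogonal to \<open>?e1\<close>, and its
      square is \<open>p\<close> times the Hessian determinant; positive definiteness thus selects
      the sign that the volume condition leaves open.\<close>
    have "h (vector [- q, p]) (vector [- q, p]) > 0"
      by (rule pos) (use \<open>p > 0\<close> in \<open>auto simp: vec_eq_iff forall_2\<close>)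
    also have "h (vector [- q, p]) (vector [- q, p]) = p * (p * r - q\<^sup>2)"
      unfolding bilinear_vec2[OF bil, of "vector [- q, p]"] sym p_def[symmetric] q_def[symmetric] r_def[symmetric]
      by (simp add: power2_eq_square algebra_simps)
    finally have "p * r - q\<^sup>2 > 0" using \<open>p > 0\<close> by (simp add: zero_less_mult_iff)
    moreover have "\<bar>p * r - q\<^sup>2\<bar> = 1" using graph(4)[OF x] by (simp only: p_def q_def r_def h_def)
    ultimately show ?thesis by (simp only: p_def q_def r_def h_def)
  qed
  interpret warped_affine_normal f N \<gamma> I \<xi>
    using graph(1,2) det curve sphere by unfold_locales (auto simp: affine_hypersphere_def)
  \<comment> \<open>The first alternative holds at every point.\<close>
  show ?thesis using Z3_symmetry by blast
qed

end
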